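(* Let $N\ge1$ be an integer, let $r,s,t>1$ and $0<\lambda<N$ satisfy $\frac1t+\frac1s=1$ and $\frac1r+\frac{\lambda}{N}>1+\frac1t$. Let $$K:=\sup\left\{\left\||i|^{-\lambda}\ast f\right\|_{t} : f\in\ell^r(\mathbb{Z}^N),\ \|f\|_r=1\right\},$$ and let $\{f_n\}\subset\ell^r(\mathbb{Z}^N)$ be a maximizing sequence, i.e. $\|f_n\|_r=1$ for all $n$ and $\left\||i|^{-\lambda}\ast f_n\right\|_t\to K$ as $n\to\infty$. Then there exists a sequence $\{i_n\}\subset\mathbb{Z}^N$ such that the sequence of translates $v_n(i):=f_n(i+i_n)$ contains a subsequence that converges in $\ell^r(\mathbb{Z}^N)$ to some $f$, and $f$ is a maximizer for $K$, i.e. $\|f\|_r=1$ and $\left\||i|^{-\lambda}\ast f\right\|_t=K$. Moreover, there exists $g\in\ell^s(\mathbb{Z}^N)$ with $\|g\|_s=1$ such that $(f,g)$ is a maximizing pair for the discrete Hardy–Littlewood–Sobolev inequality (in the supercritical case $\frac1r+\frac1s+\frac{\lambda}{N}>2$), i.e. $$\sum_{\substack{i,j\in\mathbb{Z}^N\\ i\ne j}}\frac{f(i)g(j)}{|i-j|^{\lambda}}=\sup\left\{\sum_{\substack{i,j\in\mathbb{Z}^N\\ i\ne j}}\frac{\tilde f(i)\tilde g(j)}{|i-j|^{\lambda}} : \tilde f\in\ell^r(\mathbb{Z}^N),\ \tilde g\in\ell^s(\mathbb{Z}^N),\ \|\tilde f\|_r=\|\tilde g\|_s=1\right\}.$$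
   Context: All functions on $\mathbb{Z}^N$ are real-valued, $|\cdot|$ is the Euclidean norm on $\mathbb{Z}^N\subset\mathbb{R}^N$, and $\|f\|_r=\left(\sum_{i\in\mathbb{Z}^N}|f(i)|^r\right)^{1/r}$ is the $\ell^r(\mathbb{Z}^N)$ norm. For a function $f$ on $\mathbb{Z}^N$, $$(|i|^{-\lambda}\ast f)(i):=\sum_{j\ne i}\frac{f(j)}{|i-j|^{\lambda}}.$$ The discrete Hardy–Littlewood–Sobolev inequality (known) says that for $r,s>1$, $0<\lambda<N$, $\frac1r+\frac1s+\frac\lambda N\ge2$, there is a constant $C_{r,s,\lambda}$ with $\sum_{i\ne j}\frac{f(i)g(j)}{|i-j|^\lambda}\le C_{r,s,\lambda}\|f\|_r\|g\|_s$ for all $f\in\ell^r(\mathbb{Z}^N)$, $g\in\ell^s(\mathbb{Z}^N)$; equivalently, with $\frac1t+\frac1s=1$, $\||i|^{-\lambda}\ast f\|_t\le C\|f\|_r$. Thus $K<\infty$. *)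

theory Defs
  imports "HOL-Analysis.Analysis"
begin

text \<open>
  The lattice \<open>\<int>\<^sup>N\<close> is the type \<open>int ^ 'n\<close> with \<open>N = CARD('n)\<close>.
\<close>

definition znorm :: "int ^ 'n \<Rightarrow> real"
  where "znorm i = norm ((\<chi> k. real_of_int (i $ k)) :: real ^ 'n)"

definition lp_space :: "real \<Rightarrow> ('a \<Rightarrow> real) set"
  where "lp_space r = {f. (\<lambda>i. \<bar>f i\<bar> powr r) summable_on UNIV}"

text \<open>
  The norm is extended-real valued, so that it is \<open>\<infinity>\<close>, rather than the default value
  of a divergent \<^const>\<open>infsum\<close>, outside the space; suprema of such norms are taken in
  the complete lattice \<^typ>\<open>ereal\<close>.
\<close>

definition lp_norm :: "real \<Rightarrow> ('a \<Rightarrow> real) \<Rightarrow> ereal"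
  where "lp_norm r f =
    (if f \<in> lp_space r then ereal ((\<Sum>\<^sub>\<infinity>i. \<bar>f i\<bar> powr r) powr (1 / r)) else \<infinity>)"

definition riesz_conv :: "real \<Rightarrow> (int ^ 'n \<Rightarrow> real) \<Rightarrow> int ^ 'n \<Rightarrow> real"
  where "riesz_conv l f i = (\<Sum>\<^sub>\<infinity>j\<in>{j. j \<noteq> i}. f j / znorm (i - j) powr l)"

text \<open>
  The double sum is an unconditional sum over pairs. It converges absolutely for all
  \<open>f \<in> \<ell>\<^sup>r\<close>, \<open>g \<in> \<ell>\<^sup>s\<close> by the Hardy-Littlewood-Sobolev inequality, applied to
  \<open>\<bar>f\<bar>\<close> and \<open>\<bar>g\<bar>\<close>.
\<close>

definition hls_form :: "real \<Rightarrow> (int ^ 'n \<Rightarrow> real) \<Rightarrow> (int ^ 'n \<Rightarrow> real) \<Rightarrow> real"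
  where "hls_form l f g =
    (\<Sum>\<^sub>\<infinity>(i, j)\<in>{(i, j). i \<noteq> j}. f i * g j / znorm (i - j) powr l)"

end

theory Submission
  imports Defs
begin

text \<open>
  Why maximizers exist. The hypothesis \<open>1/r + l/N > 1 + 1/t\<close> is a strict inequality, and the
  Riesz kernel \<open>\<bar>i\<bar>\<^bsup>-l\<^esup>\<close> on the lattice lies in \<open>\<ell>\<^sup>q\<close> as soon as \<open>l q > N\<close>
  (\<open>riesz_kernel_in_lp_space\<close>). Hence the Hardy-Littlewood-Sobolev inequality is in this range
  an instance of Young's convolution inequality (\<open>young_convolution\<close>), with some room left:
  the convolution is bounded into \<open>\<ell>\<^sup>t\<close> even from a slightly larger space \<open>\<ell>\<^sup>\<rho>\<close>, \<open>\<rho> > r\<close>.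

  The room supplies the compactness. By interpolation between \<open>\<ell>\<^sup>r\<close> and \<open>\<ell>\<^sup>\<infinity>\<close>, a unit vector of
  \<open>\<ell>\<^sup>r\<close> that is uniformly small is small in \<open>\<ell>\<^sup>\<rho>\<close>, so its convolution is small in \<open>\<ell>\<^sup>t\<close>. A
  maximizing sequence therefore has entries bounded away from zero, and translating these to
  the origin yields a subsequence with a nonzero pointwise limit \<open>f\<close>. It remains to exclude
  that mass escapes. The Brezis-Lieb lemma (\<open>brezis_lieb\<close>) splits the \<open>r\<close>-th powers of the norms
  of the sequence, and the \<open>t\<close>-th powers of the norms of its convolutions, into a part of \<open>f\<close>
  and a part of the remainder. If \<open>f\<close> has the fraction \<open>a > 0\<close> of the mass, then
  \<open>1 \<le> a\<^bsup>t/r\<^esup> + (1 - a)\<^bsup>t/r\<^esup>\<close>; as \<open>t > r\<close>, this forces \<open>a = 1\<close>. So the sequence converges in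
  norm and \<open>f\<close> is a maximizer. This argument is carried out for general kernels on countable
  abelian groups in \<open>maximizing_sequence_convergent\<close>.

  The second component of a maximizing pair is the unit vector of \<open>\<ell>\<^sup>s\<close> that norms the
  convolution of \<open>f\<close> (\<open>dual_extremal\<close>). By Hoelder's inequality (\<open>holder_unit_le\<close>) no pair of
  unit vectors does better.
\<close>

section \<open>Sums of \<open>p\<close>-th powers\<close>

text \<open>
  The \<open>p\<close>-th power of the norm. It is this quantity, and not the norm, that splits
  additively along weakly convergent sequences, so the compactness argument is phrased with it.
\<close>

definition lp_sum :: "real \<Rightarrow> ('a \<Rightarrow> real) \<Rightarrow> real"
  where "lp_sum p f = (\<Sum>\<^sub>\<infinity>i. \<bar>f i\<bar> powr p)"

lemma lp_sum_nonneg [simp]: "lp_sum p f \<ge> 0"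
  by (simp add: lp_sum_def infsum_nonneg)

lemma lp_norm_eq_lp_sum:
  "f \<in> lp_space p \<Longrightarrow> lp_norm p f = ereal (lp_sum p f powr (1 / p))"
  by (simp add: lp_norm_def lp_sum_def)

lemma lp_norm_eq_1_iff:
  assumes "p > 0"
  shows "lp_norm p f = 1 \<longleftrightarrow> f \<in> lp_space p \<and> lp_sum p f = 1"
proof -
  have "x = 1" if "x powr (1 / p) = 1" "x \<ge> 0" for x :: real
  proof -
    have "(x powr (1 / p)) powr p = x" using assms that(2) by (simp add: powr_powr)
    then show ?thesis by (simp add: that(1))
  qed
  from this[of "lp_sum p f"] show ?thesis
    by (cases "f \<in> lp_space p") (auto simp: lp_norm_eq_lp_sum, simp add: lp_norm_def)
qed

lemma sum_le_lp_sum: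
  assumes "f \<in> lp_space p" "finite F"
  shows "(\<Sum>i\<in>F. \<bar>f i\<bar> powr p) \<le> lp_sum p f"
  unfolding lp_sum_def using assms by (intro finite_sum_le_infsum) (auto simp: lp_space_def)

lemma powr_le_lp_sum: "f \<in> lp_space p \<Longrightarrow> \<bar>f i\<bar> powr p \<le> lp_sum p f"
  using sum_le_lp_sum[of f p "{i}"] by simp

lemma abs_le_lp_sum:
  assumes "f \<in> lp_space p" "p > 0"
  shows "\<bar>f i\<bar> \<le> lp_sum p f powr (1 / p)"
proof -
  have "(\<bar>f i\<bar> powr p) powr (1 / p) \<le> lp_sum p f powr (1 / p)"
    using assms powr_le_lp_sum by (intro powr_mono2) auto
  then show ?thesis using assms by (simp add: powr_powr)
qed

lemma lp_sum_eq_0D: "f \<in> lp_space p \<Longrightarrow> lp_sum p f = 0 \<Longrightarrow> f = (\<lambda>_. 0)"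
  using powr_le_lp_sum[of f p] by (intro ext) simp

lemma lp_space_bounded_partial_sums:
  assumes "\<And>F. finite F \<Longrightarrow> (\<Sum>i\<in>F. \<bar>f i\<bar> powr p) \<le> B"
  shows "f \<in> lp_space p" "lp_sum p f \<le> B"
proof -
  have "(\<lambda>i. \<bar>f i\<bar> powr p) summable_on UNIV"
    using assms by (intro nonneg_bdd_above_summable_on bdd_aboveI2[where M = B]) auto
  then show "f \<in> lp_space p" "lp_sum p f \<le> B"
    using assms by (auto simp: lp_space_def lp_sum_def intro: infsum_le_finite_sums)
qed

lemma lp_space_comparison:
  assumes "g summable_on UNIV" "\<And>i. \<bar>f i\<bar> powr p \<le> g i"
  shows "f \<in> lp_space p" "lp_sum p f \<le> infsum g UNIV"
proof -
  have s: "(\<lambda>i. \<bar>f i\<bar> powr p) summable_on UNIV"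
    using assms by (rule summable_on_comparison_test) auto
  then show "f \<in> lp_space p" by (simp add: lp_space_def)
  show "lp_sum p f \<le> infsum g UNIV"
    unfolding lp_sum_def using s assms by (intro infsum_mono) auto
qed

lemma lp_space_cmult:
  assumes "f \<in> lp_space p"
  shows "(\<lambda>i. c * f i) \<in> lp_space p" "lp_sum p (\<lambda>i. c * f i) = \<bar>c\<bar> powr p * lp_sum p f"
  using assms summable_on_cmult_right[of "\<lambda>i. \<bar>f i\<bar> powr p" UNIV "\<bar>c\<bar> powr p"]
  by (simp_all add: lp_space_def lp_sum_def abs_mult powr_mult infsum_cmult_right')

lemma lp_space_reindex:
  assumes "bij \<pi>"
  shows "(\<lambda>i. f (\<pi> i)) \<in> lp_space p \<longleftrightarrow> f \<in> lp_space p"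
    and "lp_sum p (\<lambda>i. f (\<pi> i)) = lp_sum p f"
  unfolding lp_space_def lp_sum_def mem_Collect_eq
  by (rule summable_on_reindex_bij_betw[OF assms, where f = "\<lambda>i. \<bar>f i\<bar> powr p"],
      rule infsum_reindex_bij_betw[OF assms, where f = "\<lambda>i. \<bar>f i\<bar> powr p"])

lemma bij_translate: "bij (\<lambda>i. i + a)" for a :: "'a::ab_group_add"
  by (rule bij_betw_byWitness[where f' = "\<lambda>i. i - a"]) auto

lemma bij_reflect: "bij (\<lambda>i. a - i)" for a :: "'a::ab_group_add"
  by (rule bij_betw_byWitness[where f' = "\<lambda>i. a - i"]) auto

lemma abs_diff_powr_le:
  fixes x y p :: real
  assumes "p > 0"
  shows "\<bar>x - y\<bar> powr p \<le> 2 powr p * (\<bar>x\<bar> powr p + \<bar>y\<bar> powr p)"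
proof -
  have "\<bar>x - y\<bar> powr p \<le> (2 * max \<bar>x\<bar> \<bar>y\<bar>) powr p"
    using assms by (intro powr_mono2) auto
  also have "\<dots> = 2 powr p * max \<bar>x\<bar> \<bar>y\<bar> powr p"
    by (simp add: powr_mult)
  also have "\<dots> \<le> 2 powr p * (\<bar>x\<bar> powr p + \<bar>y\<bar> powr p)"
    by (intro mult_left_mono) (auto simp: max_def)
  finally show ?thesis .
qed

lemma lp_space_diff:
  assumes "f \<in> lp_space p" "g \<in> lp_space p" "p > 0"
  shows "(\<lambda>i. f i - g i) \<in> lp_space p"
    and "lp_sum p (\<lambda>i. f i - g i) \<le> 2 powr p * (lp_sum p f + lp_sum p g)"
proof -
  have s: "(\<lambda>i. 2 powr p * (\<bar>f i\<bar> powr p + \<bar>g i\<bar> powr p)) summable_on UNIV"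
    using assms by (intro summable_on_cmult_right summable_on_add) (auto simp: lp_space_def)
  have "infsum (\<lambda>i. 2 powr p * (\<bar>f i\<bar> powr p + \<bar>g i\<bar> powr p)) UNIV
      = 2 powr p * (lp_sum p f + lp_sum p g)"
    using assms by (auto simp: lp_space_def lp_sum_def infsum_cmult_right' infsum_add)
  with lp_space_comparison[OF s, of "\<lambda>i. f i - g i" p] abs_diff_powr_le[OF assms(3)]
  show "(\<lambda>i. f i - g i) \<in> lp_space p"
    and "lp_sum p (\<lambda>i. f i - g i) \<le> 2 powr p * (lp_sum p f + lp_sum p g)" by auto
qed

text \<open>
  The interpolation \<open>\<parallel>f\<parallel>\<^sub>q \<le> \<parallel>f\<parallel>\<^sub>\<infinity>\<^bsup>1 - p/q\<^esup> \<parallel>f\<parallel>\<^sub>p\<^bsup>p/q\<^esup>\<close>: a unit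
  vector of \<open>\<ell>\<^sup>p\<close> that is uniformly small is small in every larger \<open>\<ell>\<^sup>q\<close>. The nesting of the
  spaces below is the same estimate with \<open>e = \<parallel>f\<parallel>\<^sub>p\<close>.
\<close>

lemma lp_space_interpolate_sup:
  assumes "f \<in> lp_space p" "0 < p" "p \<le> q" "\<And>i. \<bar>f i\<bar> \<le> e"
  shows "f \<in> lp_space q" "lp_sum q f \<le> e powr (q - p) * lp_sum p f"
proof -
  have le: "\<bar>f i\<bar> powr q \<le> e powr (q - p) * \<bar>f i\<bar> powr p" for i
  proof -
    have "\<bar>f i\<bar> powr q = \<bar>f i\<bar> powr (q - p) * \<bar>f i\<bar> powr p"
      by (simp flip: powr_add)
    also have "\<dots> \<le> e powr (q - p) * \<bar>f i\<bar> powr p"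
      using assms by (intro mult_right_mono powr_mono2) auto
    finally show ?thesis .
  qed
  have s: "(\<lambda>i. e powr (q - p) * \<bar>f i\<bar> powr p) summable_on UNIV"
    using assms by (intro summable_on_cmult_right) (auto simp: lp_space_def)
  from lp_space_comparison[OF s, of f q] le
  show "f \<in> lp_space q" "lp_sum q f \<le> e powr (q - p) * lp_sum p f"
    by (auto simp: lp_sum_def infsum_cmult_right')
qed

lemma lp_space_mono:
  assumes "f \<in> lp_space p" "0 < p" "p \<le> q"
  shows "f \<in> lp_space q"
  using lp_space_interpolate_sup(1)[OF assms] abs_le_lp_sum[OF assms(1,2)] by blast

lemma lp_space_finite_support:
  assumes "finite {i. f i \<noteq> 0}"
  shows "f \<in> lp_space p"
  unfolding lp_space_def mem_Collect_eq
  by (rule finite_nonzero_values_imp_summable_on) (use assms in \<open>simp\<close>)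

section \<open>Duality between \<open>\<ell>\<^sup>s\<close> and \<open>\<ell>\<^sup>t\<close>\<close>

lemma mult_le_powr_add_powr:
  fixes x y p q :: real
  assumes "x \<ge> 0" "y \<ge> 0" "p > 1" "q > 1" "1 / p + 1 / q = 1"
  shows "x * y \<le> x powr p + y powr q"
proof -
  have "x * y \<le> x powr p / p + y powr q / q"
    using Youngs_inequality[of p q x y] assms by auto
  also have "\<dots> \<le> x powr p / 1 + y powr q / 1"
    using assms by (intro add_mono divide_left_mono) auto
  finally show ?thesis by simp
qed

lemma summable_mult_lp:
  assumes "w \<in> lp_space p" "h \<in> lp_space q" "p > 1" "q > 1" "1 / p + 1 / q = 1"
  shows "(\<lambda>j. w j * h j) summable_on UNIV"
proof -
  have "(\<lambda>j. \<bar>w j\<bar> powr p + \<bar>h j\<bar> powr q) summable_on UNIV"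
    using assms by (intro summable_on_add) (auto simp: lp_space_def)
  moreover have "\<bar>w j * h j\<bar> \<le> \<bar>w j\<bar> powr p + \<bar>h j\<bar> powr q" for j
    unfolding abs_mult by (rule mult_le_powr_add_powr[OF abs_ge_zero abs_ge_zero assms(3-5)])
  ultimately have "(\<lambda>j. \<bar>w j * h j\<bar>) summable_on UNIV"
    by (rule summable_on_comparison_test) (rule abs_ge_zero)
  then show ?thesis
    by (subst summable_on_iff_abs_summable_on_real) simp
qed

text \<open>
  Hoelder's inequality for \<open>\<parallel>g\<parallel>\<^sub>s = 1\<close> and \<open>\<parallel>h\<parallel>\<^sub>t \<le> c\<close>, by summing the pointwise Young
  inequality for \<open>\<bar>g\<bar>\<close> and \<open>\<bar>h\<bar> / c\<close>.
\<close>

lemma holder_unit_le: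
  fixes g h :: "'a \<Rightarrow> real"
  assumes g: "g \<in> lp_space s" "lp_sum s g = 1"
    and h: "h \<in> lp_space t" "lp_sum t h \<le> c powr t"
    and st: "t > 1" "s > 1" "1 / t + 1 / s = 1" and c: "c > 0"
  shows "(\<Sum>\<^sub>\<infinity>i. g i * h i) \<le> c"
proof -
  have le: "g i * h i \<le> c * (\<bar>g i\<bar> powr s / s) + c * (\<bar>h i\<bar> powr t / c powr t / t)" for i
  proof -
    have "\<bar>g i\<bar> * (\<bar>h i\<bar> / c) \<le> \<bar>g i\<bar> powr s / s + (\<bar>h i\<bar> / c) powr t / t"
      using Youngs_inequality[of s t "\<bar>g i\<bar>" "\<bar>h i\<bar> / c"] st c by auto
    from mult_left_mono[OF this, of c] c
    have "\<bar>g i * h i\<bar> \<le> c * (\<bar>g i\<bar> powr s / s + \<bar>h i\<bar> powr t / c powr t / t)"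
      by (simp add: abs_mult powr_divide)
    then show ?thesis by (simp add: distrib_left abs_le_iff)
  qed
  have "((\<lambda>i. c * (\<bar>g i\<bar> powr s / s)) has_sum c * (1 / s)) UNIV"
    using g by (intro has_sum_cmult_right has_sum_divide_const)
      (simp add: lp_space_def lp_sum_def has_sum_iff)
  moreover have "((\<lambda>i. c * (\<bar>h i\<bar> powr t / c powr t / t)) has_sum c * (lp_sum t h / c powr t / t)) UNIV"
    using h by (intro has_sum_cmult_right has_sum_divide_const)
      (simp add: lp_space_def lp_sum_def)
  ultimately have "(\<Sum>\<^sub>\<infinity>i. g i * h i) \<le> c * (1 / s) + c * (lp_sum t h / c powr t / t)"
    using le summable_mult_lp[OF g(1) h(1)] st
    by (intro has_sum_mono[OF has_sum_infsum has_sum_add]) (auto simp: add.commute)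
  also have "\<dots> \<le> c * (1 / s) + c * (1 / t)"
    using h c st by (intro add_left_mono mult_left_mono divide_right_mono) auto
  also have "\<dots> = c"
    using st(3) by (metis add.commute distrib_left mult.right_neutral)
  finally show ?thesis .
qed

text \<open>
  The unit vector of the dual space at which the pairing with \<open>u\<close> attains \<open>\<parallel>u\<parallel>\<^sub>t\<close>; the last
  factor is \<open>\<parallel>u\<parallel>\<^sub>t\<^bsup>1 - t\<^esup>\<close> written with the \<open>t\<close>-th power sum.
\<close>

definition dual_extremal :: "real \<Rightarrow> ('a \<Rightarrow> real) \<Rightarrow> 'a \<Rightarrow> real"
  where "dual_extremal t u i = sgn (u i) * \<bar>u i\<bar> powr (t - 1) * lp_sum t u powr (1 / t - 1)"

lemma dual_extremal:
  assumes u: "u \<in> lp_space t" "lp_sum t u > 0" and st: "t > 1" "s > 1" "1 / t + 1 / s = 1"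
  shows "dual_extremal t u \<in> lp_space s" "lp_sum s (dual_extremal t u) = 1"
    and "(\<Sum>\<^sub>\<infinity>i. dual_extremal t u i * u i) = lp_sum t u powr (1 / t)"
proof -
  have sum: "((\<lambda>i. \<bar>u i\<bar> powr t) has_sum lp_sum t u) UNIV"
    using u(1) by (simp add: lp_space_def lp_sum_def)
  have ex: "(t - 1) * s = t" "(1 / t - 1) * s = -1"
    using st by (auto simp: field_simps)
  have "\<bar>dual_extremal t u i\<bar> powr s = \<bar>u i\<bar> powr t * (lp_sum t u) powr (-1)" for i
    using u(2) by (cases "u i = 0") (auto simp: dual_extremal_def abs_mult powr_mult powr_powr abs_sgn_eq ex)
  then have "((\<lambda>i. \<bar>dual_extremal t u i\<bar> powr s) has_sum (lp_sum t u * (lp_sum t u) powr (-1))) UNIV"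
    using has_sum_cmult_left[OF sum] by presburger
  then show "dual_extremal t u \<in> lp_space s" "lp_sum s (dual_extremal t u) = 1"
    using u(2) by (auto simp: lp_space_def lp_sum_def has_sum_iff powr_minus)
  have "dual_extremal t u i * u i = \<bar>u i\<bar> powr t * lp_sum t u powr (1 / t - 1)" for i
  proof -
    have "sgn (u i) * u i = \<bar>u i\<bar>" by (simp add: sgn_real_def)
    moreover have "\<bar>u i\<bar> * \<bar>u i\<bar> powr (t - 1) = \<bar>u i\<bar> powr t"
      using powr_add[of "\<bar>u i\<bar>" 1 "t - 1"] by simp
    moreover have "dual_extremal t u i * u i
        = (sgn (u i) * u i) * \<bar>u i\<bar> powr (t - 1) * lp_sum t u powr (1 / t - 1)"
      unfolding dual_extremal_def by (simp only: mult_ac)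
    ultimately show ?thesis by simp
  qed
  then have "(\<Sum>\<^sub>\<infinity>i. dual_extremal t u i * u i) = lp_sum t u * lp_sum t u powr (1 / t - 1)"
    using has_sum_cmult_left[OF sum] by (simp add: has_sum_iff)
  also have "\<dots> = lp_sum t u powr (1 / t)"
    using u(2) powr_add[of "lp_sum t u" 1 "1 / t - 1"] by simp
  finally show "(\<Sum>\<^sub>\<infinity>i. dual_extremal t u i * u i) = lp_sum t u powr (1 / t)" .
qed

text \<open>
  Testing against the dual extremal of the truncations of \<open>h\<close> to finite sets bounds all
  partial sums of \<open>\<bar>h\<bar>\<^sup>t\<close>; the truncation is what allows membership of \<open>h\<close> in \<open>\<ell>\<^sup>t\<close> to be a
  conclusion.
\<close>

lemma lp_space_by_duality:
  assumes st: "t > 1" "s > 1" "1 / t + 1 / s = 1"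
    and test: "\<And>g. g \<in> lp_space s \<Longrightarrow> lp_sum s g = 1 \<Longrightarrow> (\<Sum>\<^sub>\<infinity>i. g i * h i) \<le> C"
  shows "h \<in> lp_space t" "lp_sum t h \<le> C powr t"
proof -
  have "(\<Sum>i\<in>F. \<bar>h i\<bar> powr t) \<le> C powr t" if "finite F" for F
  proof -
    define u where "u i = (if i \<in> F then h i else 0)" for i
    have u: "u \<in> lp_space t"
      by (rule lp_space_finite_support, rule finite_subset[OF _ \<open>finite F\<close>]) (auto simp: u_def)
    have S: "lp_sum t u = (\<Sum>i\<in>F. \<bar>h i\<bar> powr t)"
      unfolding lp_sum_def
      by (subst infsum_cong_neutral[where T = F and g = "\<lambda>i. \<bar>h i\<bar> powr t"])
         (auto simp: u_def that)
    show ?thesis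
    proof (cases "lp_sum t u = 0")
      case True
      then show ?thesis by (simp flip: S)
    next
      case False
      then have pos: "lp_sum t u > 0" using lp_sum_nonneg[of t u] by linarith
      note d = dual_extremal[OF u pos st]
      have "(\<lambda>i. dual_extremal t u i * u i) = (\<lambda>i. dual_extremal t u i * h i)"
        by (auto simp: dual_extremal_def u_def)
      from arg_cong[OF this, of "\<lambda>f. infsum f UNIV"] have "lp_sum t u powr (1 / t) \<le> C"
        using test[OF d(1,2)] unfolding d(3) by linarith
      then have "(lp_sum t u powr (1 / t)) powr t \<le> C powr t"
        using st by (intro powr_mono2) auto
      then show ?thesis using st pos by (simp add: powr_powr S)
    qed
  qed
  from lp_space_bounded_partial_sums[OF this] show "h \<in> lp_space t" "lp_sum t h \<le> C powr t"
    by auto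
qed

section \<open>Young's convolution inequality\<close>

definition conv :: "('a::ab_group_add \<Rightarrow> real) \<Rightarrow> ('a \<Rightarrow> real) \<Rightarrow> 'a \<Rightarrow> real"
  where "conv k f i = (\<Sum>\<^sub>\<infinity>j. f j * k (i - j))"

text \<open>
  With \<open>a = 1 - 1/r\<close>, \<open>b = 1 - 1/q\<close>, \<open>c = 1 - 1/p\<close> the product \<open>x y z\<close> is the weighted geometric
  mean, with weights \<open>a + b + c = 1\<close>, of the three products on the right, hence at most their
  maximum.
\<close>

lemma mult3_le_powr_products:
  fixes x y z p q r :: real
  assumes "x \<ge> 0" "y \<ge> 0" "z \<ge> 0" and pqr: "p > 1" "q > 1" "r > 1" "1 / p + 1 / q + 1 / r = 2"
  shows "x * y * z \<le> x powr p * y powr q + x powr p * z powr r + y powr q * z powr r"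
proof (cases "x = 0 \<or> y = 0 \<or> z = 0")
  case True
  then show ?thesis by auto
next
  case False
  define X Y Z where "X = x powr p" and "Y = y powr q" and "Z = z powr r"
  define a b c where "a = 1 - 1 / r" and "b = 1 - 1 / q" and "c = 1 - 1 / p"
  define M where "M = X * Y + X * Z + Y * Z"
  have pos: "X > 0" "Y > 0" "Z > 0" using False by (auto simp: X_def Y_def Z_def)
  have abc: "a > 0" "b > 0" "c > 0" using pqr by (auto simp: a_def b_def c_def)
  have exps: "a + b = 1 / p" "a + c = 1 / q" "b + c = 1 / r" "a + b + c = 1"
    using pqr by (auto simp: a_def b_def c_def)
  have "x = X powr (a + b)" "y = Y powr (a + c)" "z = Z powr (b + c)"
    unfolding exps X_def Y_def Z_def using assms by (auto simp: powr_powr)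
  then have "x * y * z = (X * Y) powr a * (X * Z) powr b * (Y * Z) powr c"
    using pos by (simp add: powr_add powr_mult)
  also have "\<dots> \<le> M powr a * M powr b * M powr c"
    using pos abc by (intro mult_mono powr_mono2) (auto simp: M_def)
  also have "\<dots> = M"
    using pos exps(4) by (simp add: M_def flip: powr_add)
  finally show ?thesis by (simp add: M_def X_def Y_def Z_def)
qed

lemma has_sum_times:
  fixes f :: "'a \<Rightarrow> real" and g :: "'b \<Rightarrow> real"
  assumes "f summable_on UNIV" "g summable_on UNIV" "\<And>x. f x \<ge> 0" "\<And>y. g y \<ge> 0"
  shows "((\<lambda>(x, y). f x * g y) has_sum (infsum f UNIV * infsum g UNIV)) UNIV"
proof -
  have 1: "((\<lambda>y. f x * g y) has_sum f x * infsum g UNIV) UNIV" for x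
    using assms by (intro has_sum_cmult_right has_sum_infsum) auto
  have "(\<lambda>(x, y). f x * g y) summable_on Sigma UNIV (\<lambda>_. UNIV)"
    using 1 assms by (intro summable_on_SigmaI[where g = "\<lambda>x. f x * infsum g UNIV"]
        summable_on_cmult_left) auto
  then have s: "(\<lambda>(x, y). f x * g y) summable_on UNIV" by simp
  have "infsum (\<lambda>(x, y). f x * g y) (Sigma UNIV (\<lambda>_. UNIV)) = infsum f UNIV * infsum g UNIV"
    using s by (subst infsum_Sigma_banach[symmetric]) (auto simp: infsum_cmult_right' infsum_cmult_left')
  with s show ?thesis by (simp add: has_sum_iff)
qed

text \<open>
  Young's inequality in trilinear form. Each of the three terms of the pointwise bound
  \<open>mult3_le_powr_products\<close> depends on only two of \<open>j\<close>, \<open>i\<close>, \<open>i - j\<close>, any two of which are free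
  coordinates on the set of pairs; so its sum over all pairs factors into a product of two
  power sums. The constant is not sharp, which is harmless: only finiteness is used.
\<close>

theorem young_form_absolutely_summable:
  fixes k f g :: "'a::ab_group_add \<Rightarrow> real"
  assumes f: "f \<in> lp_space p" and g: "g \<in> lp_space r" and k: "k \<in> lp_space q"
    and pqr: "p > 1" "q > 1" "r > 1" "1 / p + 1 / q + 1 / r = 2"
  shows "(\<lambda>(i, j). \<bar>g i\<bar> * (\<bar>f j\<bar> * \<bar>k (i - j)\<bar>)) summable_on UNIV"
    and "(\<Sum>\<^sub>\<infinity>(i, j). \<bar>g i\<bar> * (\<bar>f j\<bar> * \<bar>k (i - j)\<bar>))
        \<le> lp_sum p f * lp_sum r g + lp_sum p f * lp_sum q k + lp_sum r g * lp_sum q k"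
proof -
  define F G H where "F j = \<bar>f j\<bar> powr p" and "G i = \<bar>g i\<bar> powr r" and "H m = \<bar>k m\<bar> powr q" for i j m
  have s: "F summable_on UNIV" "G summable_on UNIV" "H summable_on UNIV"
    using f g k by (auto simp: F_def[abs_def] G_def[abs_def] H_def[abs_def] lp_space_def)
  have nn: "F i \<ge> 0" "G i \<ge> 0" "H i \<ge> 0" for i by (auto simp: F_def G_def H_def)
  have sums: "infsum F UNIV = lp_sum p f" "infsum G UNIV = lp_sum r g" "infsum H UNIV = lp_sum q k"
    by (auto simp: F_def[abs_def] G_def[abs_def] H_def[abs_def] lp_sum_def)
  have FG: "((\<lambda>(i, j). F j * G i) has_sum (lp_sum p f * lp_sum r g)) UNIV"
    using has_sum_reindex_bij_witness[of UNIV prod.swap prod.swap UNIV "\<lambda>(i, j). F j * G i" "\<lambda>(x, y). F x * G y"]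
      has_sum_times[OF s(1,2) nn(1,2)] by (simp add: sums)
  have FH: "((\<lambda>(i, j). F j * H (i - j)) has_sum (lp_sum p f * lp_sum q k)) UNIV"
    using has_sum_times[OF s(1,3) nn(1,3)] unfolding sums
    by (subst has_sum_reindex_bij_witness[of UNIV "\<lambda>(x, y). (x + y, x)" "\<lambda>(i, j). (j, i - j)" UNIV
          "\<lambda>(x, y). F x * H y"]) auto
  have GH: "((\<lambda>(i, j). G i * H (i - j)) has_sum (lp_sum r g * lp_sum q k)) UNIV"
    using has_sum_times[OF s(2,3) nn(2,3)] unfolding sums
    by (subst has_sum_reindex_bij_witness[of UNIV "\<lambda>(x, y). (x, x - y)" "\<lambda>(i, j). (i, i - j)" UNIV
          "\<lambda>(x, y). G x * H y"]) auto
  have tot: "((\<lambda>(i, j). F j * G i + F j * H (i - j) + G i * H (i - j)) has_sum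
      (lp_sum p f * lp_sum r g + lp_sum p f * lp_sum q k + lp_sum r g * lp_sum q k)) UNIV"
    using has_sum_add[OF has_sum_add[OF FG FH] GH] by (simp add: case_prod_unfold)
  have le: "\<bar>g i\<bar> * (\<bar>f j\<bar> * \<bar>k (i - j)\<bar>) \<le> F j * G i + F j * H (i - j) + G i * H (i - j)" for i j
    using mult3_le_powr_products[of "\<bar>f j\<bar>" "\<bar>g i\<bar>" "\<bar>k (i - j)\<bar>" p r q] pqr
    by (simp add: F_def G_def H_def mult_ac add_ac)
  show 1: "(\<lambda>(i, j). \<bar>g i\<bar> * (\<bar>f j\<bar> * \<bar>k (i - j)\<bar>)) summable_on UNIV"
    by (rule summable_on_comparison_test[OF has_sum_imp_summable[OF tot]]) (use le in auto)
  show "(\<Sum>\<^sub>\<infinity>(i, j). \<bar>g i\<bar> * (\<bar>f j\<bar> * \<bar>k (i - j)\<bar>))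
        \<le> lp_sum p f * lp_sum r g + lp_sum p f * lp_sum q k + lp_sum r g * lp_sum q k"
    by (rule has_sum_mono[OF has_sum_infsum[OF 1] tot]) (use le in auto)
qed

lemma young_form_iterated:
  fixes k f g :: "'a::ab_group_add \<Rightarrow> real"
  assumes f: "f \<in> lp_space p" and g: "g \<in> lp_space r" and k: "k \<in> lp_space q"
    and pqr: "p > 1" "q > 1" "r > 1" "1 / p + 1 / q + 1 / r = 2"
  shows "(\<lambda>i. g i * conv k f i) summable_on UNIV"
    and "(\<Sum>\<^sub>\<infinity>(i, j). g i * (f j * k (i - j))) = (\<Sum>\<^sub>\<infinity>i. g i * conv k f i)"
    and "(\<Sum>\<^sub>\<infinity>i. g i * conv k f i)
        \<le> lp_sum p f * lp_sum r g + lp_sum p f * lp_sum q k + lp_sum r g * lp_sum q k"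
proof -
  note abs = young_form_absolutely_summable[OF assms]
  have a: "(\<lambda>(i, j). norm (g i * (f j * k (i - j)))) summable_on UNIV"
    using abs(1) by (simp add: abs_mult)
  have s: "(\<lambda>(i, j). g i * (f j * k (i - j))) summable_on UNIV"
    by (rule summable_on_iff_abs_summable_on_real[THEN iffD2]) (use a in \<open>simp add: case_prod_unfold\<close>)
  have "(\<lambda>(i, j). g i * (f j * k (i - j))) summable_on Sigma UNIV (\<lambda>_. UNIV)"
    using s by simp
  from summable_on_Sigma_banach[OF this] infsum_Sigma'_banach[OF this]
  show "(\<lambda>i. g i * conv k f i) summable_on UNIV"
    and *: "(\<Sum>\<^sub>\<infinity>(i, j). g i * (f j * k (i - j))) = (\<Sum>\<^sub>\<infinity>i. g i * conv k f i)"
    by (simp_all add: infsum_cmult_right' conv_def)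
  have "(\<Sum>\<^sub>\<infinity>(i, j). g i * (f j * k (i - j))) \<le> (\<Sum>\<^sub>\<infinity>(i, j). \<bar>g i\<bar> * (\<bar>f j\<bar> * \<bar>k (i - j)\<bar>))"
    using s abs(1) by (intro infsum_mono) (auto simp flip: abs_mult)
  with abs(2) * show "(\<Sum>\<^sub>\<infinity>i. g i * conv k f i)
        \<le> lp_sum p f * lp_sum r g + lp_sum p f * lp_sum q k + lp_sum r g * lp_sum q k" by simp
qed

lemma conv_cmult: "conv k (\<lambda>j. c * f j) = (\<lambda>i. c * conv k f i)"
  by (rule ext) (simp add: conv_def mult.assoc infsum_cmult_right')

lemma conv_translate: "conv k (\<lambda>j. f (j + a)) = (\<lambda>i. conv k f (i + a))"
proof
  fix i
  show "conv k (\<lambda>j. f (j + a)) i = conv k f (i + a)"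
    unfolding conv_def
    by (rule infsum_reindex_bij_witness[of _ "\<lambda>j. j - a" "\<lambda>j. j + a"]) (auto simp: algebra_simps)
qed

text \<open>
  Scaling: a bound on the unit sphere of \<open>\<ell>\<^sup>p\<close> extends to all of \<open>\<ell>\<^sup>p\<close>.
\<close>

lemma homogeneous_conv_bound:
  assumes f: "f \<in> lp_space p" and p: "p > 1"
    and unit: "\<And>f. f \<in> lp_space p \<Longrightarrow> lp_sum p f = 1 \<Longrightarrow>
                conv k f \<in> lp_space t \<and> lp_sum t (conv k f) \<le> C"
  shows "conv k f \<in> lp_space t \<and> lp_sum t (conv k f) \<le> C * lp_sum p f powr (t / p)"
proof (cases "lp_sum p f = 0")
  case True
  then have "conv k f = (\<lambda>_. 0)" using lp_sum_eq_0D[OF f] by (auto simp: conv_def)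
  then show ?thesis using True by (auto simp: lp_space_def lp_sum_def)
next
  case False
  define a where "a = lp_sum p f powr (1 / p)"
  have pos: "lp_sum p f > 0" using False lp_sum_nonneg[of p f] by linarith
  then have a: "a > 0" "a powr p = lp_sum p f" "a powr t = lp_sum p f powr (t / p)"
    using p by (auto simp: a_def powr_powr)
  define u where "u = (\<lambda>i. inverse a * f i)"
  have u: "u \<in> lp_space p" "lp_sum p u = 1"
    using lp_space_cmult[OF f, of "inverse a"] a pos by (auto simp: u_def powr_divide inverse_eq_divide)
  have "conv k f = conv k (\<lambda>i. a * u i)" using a by (simp add: u_def flip: mult.assoc)
  then have cf: "conv k f = (\<lambda>i. a * conv k u i)" by (simp only: conv_cmult)
  have cu: "conv k u \<in> lp_space t" "lp_sum t (conv k u) \<le> C" using unit[OF u] by auto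
  have "a powr t * lp_sum t (conv k u) \<le> a powr t * C"
    by (intro mult_left_mono cu) auto
  then show ?thesis
    using lp_space_cmult[OF cu(1), of a] a(1) by (simp add: cf mult.commute flip: a(3))
qed

theorem young_convolution:
  fixes k :: "'a::ab_group_add \<Rightarrow> real"
  assumes k: "k \<in> lp_space q" and pqt: "p > 1" "q > 1" "t > 1" "1 / p + 1 / q = 1 + 1 / t"
  obtains C where "C \<ge> 0"
    "\<And>f. f \<in> lp_space p \<Longrightarrow>
        conv k f \<in> lp_space t \<and> lp_sum t (conv k f) \<le> C * lp_sum p f powr (t / p)"
proof -
  define s where "s = t / (t - 1)"
  have s: "s > 1" "1 / t + 1 / s = 1" using pqt by (auto simp: s_def field_simps)
  have e: "1 / p + 1 / q + 1 / s = 2" using pqt s by linarith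
  define C where "C = (1 + 2 * lp_sum q k) powr t"
  have "conv k f \<in> lp_space t \<and> lp_sum t (conv k f) \<le> C"
    if f: "f \<in> lp_space p" "lp_sum p f = 1" for f
  proof -
    have "(\<Sum>\<^sub>\<infinity>i. g i * conv k f i) \<le> 1 + 2 * lp_sum q k" if "g \<in> lp_space s" "lp_sum s g = 1" for g
      using young_form_iterated(3)[OF f(1) that(1) k pqt(1,2) s(1) e] by (simp add: f that)
    then show ?thesis using lp_space_by_duality[OF pqt(3) s, of "conv k f" "1 + 2 * lp_sum q k"]
      by (simp add: C_def)
  qed
  note unit = this
  show ?thesis
  proof (rule that)
    show "C \<ge> 0" by (simp add: C_def)
    show "conv k f \<in> lp_space t \<and> lp_sum t (conv k f) \<le> C * lp_sum p f powr (t / p)"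
      if "f \<in> lp_space p" for f
      by (rule homogeneous_conv_bound[OF that pqt(1) unit])
  qed
qed

section \<open>Compactness tools\<close>

text \<open>
  A substitute for dominated convergence when there is no fixed summable majorant: off a
  finite set the fixed part \<open>e\<close> of the majorant is negligible, and the moving part \<open>u n\<close>
  enters with an arbitrarily small factor and has bounded sum. Both weak convergence and
  the Brezis-Lieb lemma are instances.
\<close>

lemma dominated_infsum_tendsto_0:
  fixes d u :: "nat \<Rightarrow> 'a \<Rightarrow> real"
  assumes d: "\<And>n. d n summable_on UNIV" "\<And>i. (\<lambda>n. d n i) \<longlonglongrightarrow> 0"
    and u: "\<And>n. u n summable_on UNIV" "\<And>n i. u n i \<ge> 0" "\<And>n. (\<Sum>\<^sub>\<infinity>i. u n i) \<le> M"
    and bound: "\<And>\<epsilon>. \<epsilon> > 0 \<Longrightarrow> \<exists>e. e summable_on UNIV \<and> (\<forall>n i. \<bar>d n i\<bar> \<le> \<epsilon> * u n i + e i)"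
  shows "(\<lambda>n. \<Sum>\<^sub>\<infinity>i. d n i) \<longlonglongrightarrow> 0"
proof (rule LIMSEQ_I)
  fix \<eta> :: real
  assume "\<eta> > 0"
  define \<epsilon> where "\<epsilon> = \<eta> / (4 * (\<bar>M\<bar> + 1))"
  have \<epsilon>: "\<epsilon> > 0" "\<epsilon> * \<bar>M\<bar> \<le> \<eta> / 4" using \<open>\<eta> > 0\<close> by (auto simp: \<epsilon>_def field_simps)
  obtain e where e: "e summable_on UNIV" "\<And>n i. \<bar>d n i\<bar> \<le> \<epsilon> * u n i + e i"
    using bound[OF \<epsilon>(1)] by blast
  obtain F where F: "finite F" "dist (sum e F) (infsum e UNIV) \<le> \<eta> / 4"
    using infsum_finite_approximation[OF e(1), of "\<eta> / 4"] \<open>\<eta> > 0\<close> by auto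
  have compl: "f summable_on - F" if "f summable_on UNIV" for f :: "'a \<Rightarrow> real"
    using that summable_on_subset_banach by blast
  have split: "infsum f UNIV = sum f F + infsum f (- F)" if "f summable_on UNIV" for f :: "'a \<Rightarrow> real"
    using infsum_Un_disjoint[of f F "- F"] F(1) compl[OF that] by simp
  have e_tail: "infsum e (- F) \<le> \<eta> / 4"
    using F(2) split[OF e(1)] by (simp add: dist_real_def)
  have "(\<lambda>n. \<Sum>i\<in>F. \<bar>d n i\<bar>) \<longlonglongrightarrow> (\<Sum>i\<in>F. 0)"
    using d(2) by (intro tendsto_sum) (simp add: tendsto_rabs_zero)
  then obtain n0 where n0: "\<And>n. n \<ge> n0 \<Longrightarrow> (\<Sum>i\<in>F. \<bar>d n i\<bar>) < \<eta> / 4"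
    using LIMSEQ_D[of "\<lambda>n. \<Sum>i\<in>F. \<bar>d n i\<bar>" 0 "\<eta> / 4"] \<open>\<eta> > 0\<close> by (auto simp: abs_less_iff)
  have "norm ((\<Sum>\<^sub>\<infinity>i. d n i) - 0) < \<eta>" if "n \<ge> n0" for n
  proof -
    have a: "(\<lambda>i. \<bar>d n i\<bar>) summable_on UNIV"
      using d(1)[of n, THEN summable_on_iff_abs_summable_on_real[THEN iffD1]] by simp
    have eu: "(\<lambda>i. \<epsilon> * u n i) summable_on - F"
      using compl[OF u(1)] by (rule summable_on_cmult_right)
    have "infsum (u n) (- F) \<le> infsum (u n) UNIV"
      using split[OF u(1), of n] sum_nonneg[of F "u n"] u(2) by auto
    then have "infsum (u n) (- F) \<le> \<bar>M\<bar>"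
      using u(3)[of n] by linarith
    then have "\<epsilon> * infsum (u n) (- F) \<le> \<eta> / 4"
      using \<epsilon> mult_left_mono[of "infsum (u n) (- F)" "\<bar>M\<bar>" \<epsilon>] by linarith
    then have eu_le: "(\<Sum>\<^sub>\<infinity>i\<in>-F. \<epsilon> * u n i) \<le> \<eta> / 4"
      by (simp add: infsum_cmult_right')
    have "\<bar>\<Sum>\<^sub>\<infinity>i. d n i\<bar> \<le> (\<Sum>\<^sub>\<infinity>i. \<bar>d n i\<bar>)"
      using norm_infsum_bound[of "d n" UNIV] a by simp
    also have "\<dots> = (\<Sum>i\<in>F. \<bar>d n i\<bar>) + (\<Sum>\<^sub>\<infinity>i\<in>-F. \<bar>d n i\<bar>)"
      by (rule split[OF a])
    also have "(\<Sum>\<^sub>\<infinity>i\<in>-F. \<bar>d n i\<bar>) \<le> (\<Sum>\<^sub>\<infinity>i\<in>-F. \<epsilon> * u n i + e i)"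
      using e(2) by (intro infsum_mono summable_on_add compl[OF a] compl[OF e(1)] eu)
    also have "\<dots> = (\<Sum>\<^sub>\<infinity>i\<in>-F. \<epsilon> * u n i) + infsum e (- F)"
      by (intro infsum_add eu compl[OF e(1)])
    finally show ?thesis
      using e_tail eu_le n0[OF that] \<open>\<eta> > 0\<close> unfolding real_norm_def by linarith
  qed
  then show "\<exists>n0. \<forall>n\<ge>n0. norm ((\<Sum>\<^sub>\<infinity>i. d n i) - 0) < \<eta>" by blast
qed

lemma mult_le_eps_powr:
  fixes p q \<epsilon> :: real
  assumes "p > 1" "q > 1" "1 / p + 1 / q = 1" "\<epsilon> > 0"
  obtains C where "\<And>x y. x \<ge> 0 \<Longrightarrow> y \<ge> 0 \<Longrightarrow> x * y \<le> \<epsilon> * x powr p + C * y powr q"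
proof
  fix x y :: real
  assume xy: "x \<ge> 0" "y \<ge> 0"
  have "x * y = (\<epsilon> powr (1 / p) * x) * (\<epsilon> powr (- 1 / p) * y)"
    using assms(4) by (simp add: powr_minus field_simps)
  also have "\<dots> \<le> (\<epsilon> powr (1 / p) * x) powr p + (\<epsilon> powr (- 1 / p) * y) powr q"
    using assms xy by (intro mult_le_powr_add_powr) auto
  also have "\<dots> = \<epsilon> * x powr p + \<epsilon> powr (- q / p) * y powr q"
    using assms xy by (simp add: powr_mult powr_powr)
  finally show "x * y \<le> \<epsilon> * x powr p + \<epsilon> powr (- q / p) * y powr q" .
qed

text \<open>
  Bounded pointwise null sequences of \<open>\<ell>\<^sup>p\<close> are weakly null. For a convolution this gives
  pointwise convergence, each value being the pairing with a reflected translate of the kernel.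
\<close>

lemma pairing_tendsto_0:
  assumes w: "\<And>n. w n \<in> lp_space p" "\<And>n. lp_sum p (w n) \<le> M" "\<And>i. (\<lambda>n. w n i) \<longlonglongrightarrow> 0"
    and h: "h \<in> lp_space q" and pq: "p > 1" "q > 1" "1 / p + 1 / q = 1"
  shows "(\<lambda>n. \<Sum>\<^sub>\<infinity>j. w n j * h j) \<longlonglongrightarrow> 0"
proof (rule dominated_infsum_tendsto_0[where u = "\<lambda>n i. \<bar>w n i\<bar> powr p" and M = M])
  show "(\<lambda>i. w n i * h i) summable_on UNIV" for n
    using summable_mult_lp[OF w(1) h pq] .
  show "(\<lambda>n. w n i * h i) \<longlonglongrightarrow> 0" for i
    using tendsto_mult_left_zero[OF w(3)] by simp
  show "(\<lambda>i. \<bar>w n i\<bar> powr p) summable_on UNIV" "(\<Sum>\<^sub>\<infinity>i. \<bar>w n i\<bar> powr p) \<le> M" for n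
    using w(1,2)[of n] by (auto simp: lp_space_def lp_sum_def)
  fix \<epsilon> :: real
  assume "\<epsilon> > 0"
  then obtain C where C: "\<And>x y. x \<ge> 0 \<Longrightarrow> y \<ge> 0 \<Longrightarrow> x * y \<le> \<epsilon> * x powr p + C * y powr q"
    using mult_le_eps_powr[OF pq] by blast
  have "(\<lambda>i. C * \<bar>h i\<bar> powr q) summable_on UNIV"
    using h by (intro summable_on_cmult_right) (auto simp: lp_space_def)
  then show "\<exists>e. e summable_on UNIV \<and> (\<forall>n i. \<bar>w n i * h i\<bar> \<le> \<epsilon> * \<bar>w n i\<bar> powr p + e i)"
    using C[OF abs_ge_zero abs_ge_zero]
    by (intro exI[of _ "\<lambda>i. C * \<bar>h i\<bar> powr q"]) (simp add: abs_mult)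
qed auto

text \<open>
  If \<open>y\<close> is at most a small multiple \<open>\<delta> x\<close>, then \<open>(x + y)\<^sup>p \<le> (1 + \<delta>)\<^sup>p x\<^sup>p\<close>; otherwise \<open>x + y\<close> is at
  most a multiple of \<open>y\<close>.
\<close>

lemma powr_add_le_eps:
  fixes p \<epsilon> :: real
  assumes "p > 0" "\<epsilon> > 0"
  obtains C where "C \<ge> 0"
    "\<And>x y. x \<ge> 0 \<Longrightarrow> y \<ge> 0 \<Longrightarrow> (x + y) powr p \<le> (1 + \<epsilon>) * x powr p + C * y powr p"
proof
  define \<delta> where "\<delta> = (1 + \<epsilon>) powr (1 / p) - 1"
  have \<delta>: "\<delta> > 0" "(1 + \<delta>) powr p = 1 + \<epsilon>"
    using assms gr_one_powr[of "1 + \<epsilon>" "1 / p"] by (auto simp: \<delta>_def powr_powr)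
  show "(1 + 1 / \<delta>) powr p \<ge> 0" by simp
  fix x y :: real
  assume xy: "x \<ge> 0" "y \<ge> 0"
  show "(x + y) powr p \<le> (1 + \<epsilon>) * x powr p + (1 + 1 / \<delta>) powr p * y powr p"
  proof (cases "y \<le> \<delta> * x")
    case True
    then have "(x + y) powr p \<le> ((1 + \<delta>) * x) powr p"
      using assms xy by (intro powr_mono2) (auto simp: algebra_simps)
    also have "\<dots> = (1 + \<epsilon>) * x powr p" using xy \<delta> by (simp add: powr_mult)
    finally show ?thesis by (smt (verit) mult_nonneg_nonneg powr_ge_zero)
  next
    case False
    then have "x \<le> y / \<delta>" using \<delta> by (simp add: field_simps)
    then have "(x + y) powr p \<le> ((1 + 1 / \<delta>) * y) powr p"
      using assms xy by (intro powr_mono2) (auto simp: algebra_simps)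
    also have "\<dots> = (1 + 1 / \<delta>) powr p * y powr p" using xy \<delta> by (simp add: powr_mult)
    finally show ?thesis using assms by (smt (verit) mult_nonneg_nonneg powr_ge_zero)
  qed
qed

text \<open>
  Where \<open>f\<close> is not negligible, that is on a finite set, the difference \<open>v n - f\<close> tends to zero;
  elsewhere \<open>\<bar>v n\<bar>\<^sup>p\<close> and \<open>\<bar>v n - f\<bar>\<^sup>p\<close> differ by a small fraction of themselves and a multiple of
  \<open>\<bar>f\<bar>\<^sup>p\<close>, by \<open>powr_add_le_eps\<close>.
\<close>

theorem brezis_lieb:
  assumes v: "\<And>n. v n \<in> lp_space p" "\<And>n. lp_sum p (v n) \<le> M" "\<And>i. (\<lambda>n. v n i) \<longlonglongrightarrow> f i"
    and f: "f \<in> lp_space p" and p: "p > 0"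
  shows "(\<lambda>n. lp_sum p (v n) - lp_sum p (\<lambda>i. v n i - f i)) \<longlonglongrightarrow> lp_sum p f"
proof -
  define d where "d n i = \<bar>v n i\<bar> powr p - \<bar>v n i - f i\<bar> powr p - \<bar>f i\<bar> powr p" for n i
  define u where "u n i = \<bar>v n i\<bar> powr p + \<bar>v n i - f i\<bar> powr p" for n i
  have sv: "(\<lambda>i. \<bar>v n i\<bar> powr p) summable_on UNIV" for n
    using v(1)[of n] by (auto simp: lp_space_def)
  have sw: "(\<lambda>i. \<bar>v n i - f i\<bar> powr p) summable_on UNIV" for n
    using lp_space_diff(1)[OF v(1) f p, of n] by (auto simp: lp_space_def)
  have sf: "(\<lambda>i. \<bar>f i\<bar> powr p) summable_on UNIV" using f by (auto simp: lp_space_def)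
  have sum_d: "(d n has_sum (lp_sum p (v n) - lp_sum p (\<lambda>i. v n i - f i) - lp_sum p f)) UNIV" for n
  proof -
    have "((\<lambda>i. (\<bar>v n i\<bar> powr p + - (\<bar>v n i - f i\<bar> powr p)) + - (\<bar>f i\<bar> powr p)) has_sum
        (lp_sum p (v n) + - lp_sum p (\<lambda>i. v n i - f i) + - lp_sum p f)) UNIV"
      unfolding lp_sum_def by (intro has_sum_add has_sum_uminusI has_sum_infsum sv sw sf)
    then show ?thesis by (simp add: d_def[abs_def])
  qed
  have sum_u: "(u n has_sum (lp_sum p (v n) + lp_sum p (\<lambda>i. v n i - f i))) UNIV" for n
    unfolding lp_sum_def u_def by (intro has_sum_add has_sum_infsum sv sw)
  have "(\<lambda>n. \<Sum>\<^sub>\<infinity>i. d n i) \<longlonglongrightarrow> 0"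
  proof (rule dominated_infsum_tendsto_0[where u = u])
    show "d n summable_on UNIV" for n using sum_d by (rule has_sum_imp_summable)
    show "u n summable_on UNIV" for n using sum_u by (rule has_sum_imp_summable)
    show "u n i \<ge> 0" for n i by (simp add: u_def)
    show "(\<Sum>\<^sub>\<infinity>i. u n i) \<le> M + 2 powr p * (M + lp_sum p f)" for n
    proof -
      have "2 powr p * (lp_sum p (v n) + lp_sum p f) \<le> 2 powr p * (M + lp_sum p f)"
        using v(2) by (intro mult_left_mono) auto
      then show ?thesis
        using infsumI[OF sum_u, of n] lp_space_diff(2)[OF v(1) f p, of n] v(2)[of n] by linarith
    qed
    have "(\<lambda>n. d n i) \<longlonglongrightarrow> \<bar>f i\<bar> powr p - \<bar>f i - f i\<bar> powr p - \<bar>f i\<bar> powr p" for i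
      unfolding d_def using p v(3) by (intro tendsto_intros tendsto_powr') auto
    then show "(\<lambda>n. d n i) \<longlonglongrightarrow> 0" for i by simp
    fix \<epsilon> :: real
    assume "\<epsilon> > 0"
    then obtain C where C: "C \<ge> 0"
      "\<And>x y. x \<ge> 0 \<Longrightarrow> y \<ge> 0 \<Longrightarrow> (x + y) powr p \<le> (1 + \<epsilon>) * x powr p + C * y powr p"
      using powr_add_le_eps[OF p] by blast
    have key: "\<bar>b\<bar> powr p \<le> (1 + \<epsilon>) * \<bar>a\<bar> powr p + C * \<bar>c\<bar> powr p" if "\<bar>b\<bar> \<le> \<bar>a\<bar> + \<bar>c\<bar>" for a b c :: real
      using order_trans[OF powr_mono2[OF _ _ that, of p] C(2)[of "\<bar>a\<bar>" "\<bar>c\<bar>"]] p by auto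
    have "\<bar>d n i\<bar> \<le> \<epsilon> * u n i + (C + 1) * \<bar>f i\<bar> powr p" for n i
    proof -
      have A: "\<bar>v n i\<bar> powr p \<le> (1 + \<epsilon>) * \<bar>v n i - f i\<bar> powr p + C * \<bar>f i\<bar> powr p"
        and B: "\<bar>v n i - f i\<bar> powr p \<le> (1 + \<epsilon>) * \<bar>v n i\<bar> powr p + C * \<bar>f i\<bar> powr p"
        by (rule key; linarith)+
      have nn: "\<epsilon> * \<bar>v n i\<bar> powr p \<ge> 0" "\<epsilon> * \<bar>v n i - f i\<bar> powr p \<ge> 0" "C * \<bar>f i\<bar> powr p \<ge> 0" "\<bar>f i\<bar> powr p \<ge> 0"
        using \<open>\<epsilon> > 0\<close> C(1) by auto
      show ?thesis
        unfolding d_def u_def abs_le_iff distrib_left distrib_right mult_1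
        using A[unfolded distrib_right mult_1] B[unfolded distrib_right mult_1] nn by linarith
    qed
    moreover have "(\<lambda>i. (C + 1) * \<bar>f i\<bar> powr p) summable_on UNIV"
      using sf by (rule summable_on_cmult_right)
    ultimately show "\<exists>e. e summable_on UNIV \<and> (\<forall>n i. \<bar>d n i\<bar> \<le> \<epsilon> * u n i + e i)" by blast
  qed
  then have "(\<lambda>n. lp_sum p (v n) - lp_sum p (\<lambda>i. v n i - f i) - lp_sum p f) \<longlonglongrightarrow> 0"
    using infsumI[OF sum_d] by simp
  from tendsto_add[OF this tendsto_const[of "lp_sum p f"]] show ?thesis by simp
qed

lemma lp_pointwise_limit:
  assumes v: "\<And>n. v n \<in> lp_space p" "\<And>n. lp_sum p (v n) \<le> M" "\<And>i. (\<lambda>n. v n i) \<longlonglongrightarrow> f i"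
    and p: "p > 0"
  shows "f \<in> lp_space p" "lp_sum p f \<le> M"
proof -
  have "(\<Sum>i\<in>F. \<bar>f i\<bar> powr p) \<le> M" if "finite F" for F
  proof (rule LIMSEQ_le_const2)
    show "(\<lambda>n. \<Sum>i\<in>F. \<bar>v n i\<bar> powr p) \<longlonglongrightarrow> (\<Sum>i\<in>F. \<bar>f i\<bar> powr p)"
      using p v(3) by (intro tendsto_intros tendsto_powr') auto
    show "\<exists>n0. \<forall>n\<ge>n0. (\<Sum>i\<in>F. \<bar>v n i\<bar> powr p) \<le> M"
      using sum_le_lp_sum[OF v(1) that] v(2) by (meson order_trans)
  qed
  from lp_space_bounded_partial_sums[OF this] show "f \<in> lp_space p" "lp_sum p f \<le> M" by auto
qed

text \<open>
  Tychonoff's theorem replaces the diagonal argument: a cube with countably many coordinates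
  is compact and first countable, hence sequentially compact.
\<close>

lemma pointwise_convergent_subsequence:
  fixes v :: "nat \<Rightarrow> 'a::countable \<Rightarrow> real"
  assumes "\<And>n i. \<bar>v n i\<bar> \<le> B"
  obtains f \<sigma> where "strict_mono \<sigma>" "\<And>i. (\<lambda>n. v (\<sigma> n) i) \<longlonglongrightarrow> f i"
proof -
  have "compactin (product_topology (\<lambda>_. euclidean) UNIV) (PiE UNIV (\<lambda>_::'a. {- B..B}))"
    by (simp add: compactin_PiE)
  then have "seq_compact (PiE UNIV (\<lambda>_::'a. {- B..B}))"
    by (simp add: euclidean_product_topology compact_imp_seq_compact)
  moreover have "v n \<in> PiE UNIV (\<lambda>_::'a. {- B..B})" for n
    using assms by (auto simp: PiE_def abs_le_iff minus_le_iff)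
  ultimately obtain f \<sigma> where \<sigma>: "strict_mono \<sigma>" "(v \<circ> \<sigma>) \<longlonglongrightarrow> f"
    unfolding seq_compact_def by blast
  have "(\<lambda>n. v (\<sigma> n) i) \<longlonglongrightarrow> f i" for i
    using continuous_on_tendsto_compose[OF continuous_on_product_coordinates[of i] \<sigma>(2)]
    by (simp add: o_def)
  with \<sigma>(1) show ?thesis by (rule that)
qed

text \<open>
  The inequality that forbids a maximizing sequence to split into two nontrivial pieces.
\<close>

lemma powr_sum_less_1:
  fixes a \<theta> :: real
  assumes "0 < a" "a < 1" "\<theta> > 1"
  shows "a powr \<theta> + (1 - a) powr \<theta> < 1"
proof -
  have "x powr \<theta> < x" if "0 < x" "x < 1" for x :: real
    using powr_less_mono'[of x 1 \<theta>] that assms by simp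
  from this[of a] this[of "1 - a"] show ?thesis using assms by simp
qed

section \<open>Maximizing sequences for convolution operators\<close>

text \<open>
  On any countable abelian group: if the kernel is better than the exponents require, then
  maximizing sequences converge up to translations and subsequences. Here \<open>B\<close> is the \<open>t\<close>-th
  power of the operator norm.
  
  The slack in the exponents gives boundedness of the convolution on \<open>\<ell>\<^sup>\<rho>\<close> for some \<open>\<rho> > r\<close>.
  By interpolation a uniformly small \<open>fn n\<close> is small in \<open>\<ell>\<^sup>\<rho>\<close> and cannot be nearly maximizing, so
  after translation the entry at the origin stays above a constant and a pointwise limit \<open>f\<close> is not zero. Let
  \<open>a\<close> be the power sum of \<open>f\<close>. The Brezis-Lieb lemma in \<open>\<ell>\<^sup>r\<close> and in \<open>\<ell>\<^sup>t\<close> gives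
  \<open>B \<le> B (a\<^bsup>t/r\<^esup> + (1 - a)\<^bsup>t/r\<^esup>)\<close>, which forces \<open>a = 1\<close> as \<open>t > r\<close>; so no mass escapes.
\<close>

theorem maximizing_sequence_convergent:
  fixes k :: "'a::{ab_group_add, countable} \<Rightarrow> real" and fn :: "nat \<Rightarrow> 'a \<Rightarrow> real"
  assumes k: "k \<in> lp_space q"
    and rqt: "r > 1" "q > 1" "t > 1" "1 / r + 1 / q > 1 + 1 / t"
    and B: "B > 0" "\<And>f. f \<in> lp_space r \<Longrightarrow> lp_sum t (conv k f) \<le> B * lp_sum r f powr (t / r)"
    and fn: "\<And>n. fn n \<in> lp_space r" "\<And>n. lp_sum r (fn n) = 1"
    and max: "(\<lambda>n. lp_sum t (conv k (fn n))) \<longlonglongrightarrow> B"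
  obtains tr \<sigma> f where "strict_mono \<sigma>" "f \<in> lp_space r"
    "(\<lambda>n. lp_sum r (\<lambda>i. fn (\<sigma> n) (i + tr (\<sigma> n)) - f i)) \<longlonglongrightarrow> 0"
    "lp_sum r f = 1" "lp_sum t (conv k f) = B"
proof -
  \<comment> \<open>The exponent that Young's inequality pairs with the kernel exponent \<open>q\<close>; the slack puts it strictly between \<open>r\<close> and \<open>t\<close>.\<close>
  define \<rho> where "\<rho> = 1 / (1 + 1 / t - 1 / q)"
  have inv_\<rho>: "1 / \<rho> = 1 + 1 / t - 1 / q" by (simp add: \<rho>_def)
  have t_\<rho>: "1 / t < 1 / \<rho>" "1 / \<rho> < 1 / r" using rqt by (auto simp: inv_\<rho>)
  have "1 / t > 0" using rqt by simp
  then have "\<rho> > 0" using t_\<rho>(1) zero_less_divide_1_iff[of \<rho>] by linarith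
  then have "r < \<rho>" "\<rho> < t"
    using t_\<rho> rqt(1,3) by (auto simp: field_simps)
  then have \<rho>: "r < \<rho>" "\<rho> > 1" "\<rho> < t" "1 / \<rho> + 1 / q = 1 + 1 / t"
    using rqt inv_\<rho> by auto
  obtain C where C: "C \<ge> 0" "\<And>f. f \<in> lp_space \<rho> \<Longrightarrow>
        conv k f \<in> lp_space t \<and> lp_sum t (conv k f) \<le> C * lp_sum \<rho> f powr (t / \<rho>)"
    using young_convolution[OF k \<rho>(2) rqt(2,3) \<rho>(4)] by blast
  have conv_lt: "conv k f \<in> lp_space t" if "f \<in> lp_space r" for f
    using C(2)[of f] lp_space_mono[OF that, of \<rho>] rqt \<rho> by auto

  \<comment> \<open>The threshold below which the sup norm excludes near-maximality.\<close>
  obtain \<delta> where \<delta>: "\<delta> > 0" "C * \<delta> powr ((\<rho> - r) * (t / \<rho>)) < B"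
  proof -
    have "((\<lambda>\<delta>. C * \<delta> powr ((\<rho> - r) * (t / \<rho>))) \<longlongrightarrow> C * 0 powr ((\<rho> - r) * (t / \<rho>))) (at_right 0)"
      using \<rho> rqt by (intro tendsto_intros tendsto_powr') (auto simp: eventually_at_filter)
    then have "eventually (\<lambda>\<delta>. C * \<delta> powr ((\<rho> - r) * (t / \<rho>)) < B) (at_right 0)"
      using B(1) by (intro order_tendstoD(2)) auto
    moreover have "eventually (\<lambda>\<delta>::real. \<delta> > 0) (at_right 0)" by (simp add: eventually_at_right_less)
    ultimately have "eventually (\<lambda>\<delta>. C * \<delta> powr ((\<rho> - r) * (t / \<rho>)) < B \<and> \<delta> > 0) (at_right 0)"
      by (rule eventually_conj)
    then obtain \<delta> where "C * \<delta> powr ((\<rho> - r) * (t / \<rho>)) < B \<and> \<delta> > 0"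
      using eventually_happens' trivial_limit_at_right_real by blast
    then show ?thesis using that by blast
  qed
  have small: "lp_sum t (conv k (fn n)) \<le> C * \<delta> powr ((\<rho> - r) * (t / \<rho>))" if "\<And>i. \<bar>fn n i\<bar> \<le> \<delta>" for n
  proof -
    have "fn n \<in> lp_space \<rho>" "lp_sum \<rho> (fn n) \<le> \<delta> powr (\<rho> - r)"
      using lp_space_interpolate_sup[OF fn(1)[of n] _ _ that, of \<rho>] fn(2)[of n] rqt \<rho> by auto
    then have "lp_sum \<rho> (fn n) powr (t / \<rho>) \<le> (\<delta> powr (\<rho> - r)) powr (t / \<rho>)"
      using rqt \<rho> by (intro powr_mono2) auto
    then have "C * lp_sum \<rho> (fn n) powr (t / \<rho>) \<le> C * \<delta> powr ((\<rho> - r) * (t / \<rho>))"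
      using C(1) by (intro mult_left_mono) (auto simp: powr_powr)
    then show ?thesis using C(2)[OF \<open>fn n \<in> lp_space \<rho>\<close>] by linarith
  qed
  have "eventually (\<lambda>n. lp_sum t (conv k (fn n)) > C * \<delta> powr ((\<rho> - r) * (t / \<rho>))) sequentially"
    using max \<delta>(2) by (rule order_tendstoD(1))
  then have "eventually (\<lambda>n. \<exists>i. \<bar>fn n i\<bar> > \<delta>) sequentially"
    by eventually_elim (use small in \<open>force simp: not_le\<close>)
  then obtain n0 where "\<And>n. n \<ge> n0 \<Longrightarrow> \<exists>i. \<bar>fn n i\<bar> > \<delta>"
    by (auto simp: eventually_sequentially)
  then obtain tr where tr: "\<And>n. n \<ge> n0 \<Longrightarrow> \<bar>fn n (tr n)\<bar> > \<delta>" by metis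

  define v where "v n i = fn n (i + tr n)" for n i
  have v: "v n \<in> lp_space r" "lp_sum r (v n) = 1" "conv k (v n) = (\<lambda>i. conv k (fn n) (i + tr n))" for n
    unfolding v_def using lp_space_reindex[OF bij_translate, where f = "fn n" and p = r] fn
    by (simp_all add: conv_translate)
  have conv_v: "lp_sum t (conv k (v n)) = lp_sum t (conv k (fn n))" for n
    unfolding v(3) by (rule lp_space_reindex[OF bij_translate])
  have "\<bar>v n i\<bar> \<le> 1" for n i
    using abs_le_lp_sum[OF v(1), of n i] v(2)[of n] rqt by simp
  then obtain f \<sigma> where \<sigma>: "strict_mono \<sigma>" and f_lim: "\<And>i. (\<lambda>n. v (\<sigma> n) i) \<longlonglongrightarrow> f i"
    using pointwise_convergent_subsequence[of v 1] by blast
  have f: "f \<in> lp_space r" "lp_sum r f \<le> 1"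
    using lp_pointwise_limit[of "\<lambda>n. v (\<sigma> n)" r 1 f] v f_lim rqt by auto
  have f_pos: "lp_sum r f > 0"
  proof -
    have "\<bar>v (\<sigma> n) 0\<bar> > \<delta>" if "n \<ge> n0" for n
      using tr[of "\<sigma> n"] seq_suble[OF \<sigma>, of n] that by (simp add: v_def)
    then have "\<bar>f 0\<bar> \<ge> \<delta>"
      by (intro LIMSEQ_le_const[OF tendsto_rabs[OF f_lim[of 0]]]) (auto intro: less_imp_le)
    then have "0 < \<bar>f 0\<bar> powr r" using \<delta> by simp
    also have "\<dots> \<le> lp_sum r f" by (rule powr_le_lp_sum[OF f(1)])
    finally show ?thesis .
  qed

  \<comment> \<open>The escaping part.\<close>
  define w where "w n i = v (\<sigma> n) i - f i" for n i
  have w: "w n \<in> lp_space r" "lp_sum r (w n) \<le> 2 powr r * (1 + lp_sum r f)" for n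
    unfolding w_def using lp_space_diff[OF v(1) f(1), of "\<sigma> n"] v(2) rqt by auto
  have w_lim: "(\<lambda>n. w n i) \<longlonglongrightarrow> 0" for i
    unfolding w_def using f_lim[of i] by (simp add: LIM_zero)
  \<comment> \<open>The exponent dual to \<open>r\<close>. As \<open>q \<le> r'\<close>, every value of a convolution is a pairing of \<open>\<ell>\<^sup>r\<close> with \<open>\<ell>\<^bsup>r'\<^esup>\<close>.\<close>
  define r' where "r' = r / (r - 1)"
  have r': "r' > 1" "1 / r + 1 / r' = 1" using rqt by (auto simp: r'_def field_simps)
  have "1 / r' < 1 / q" using rqt r' \<open>1 / t > 0\<close> by linarith
  then have "q \<le> r'" using rqt r' by (simp add: field_simps)
  have k': "(\<lambda>j. k (i - j)) \<in> lp_space r'" for i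
    using lp_space_mono[OF k, of r'] lp_space_reindex(1)[OF bij_reflect, where f = k and p = r'] rqt \<open>q \<le> r'\<close> by simp
  have conv_w: "conv k (w n) i = conv k (v (\<sigma> n)) i - conv k f i" for n i
  proof -
    have s: "(\<lambda>j. g j * k (i - j)) summable_on UNIV" if "g \<in> lp_space r" for g
      using summable_mult_lp[OF that k' rqt(1) r'] .
    have "((\<lambda>j. v (\<sigma> n) j * k (i - j) + - (f j * k (i - j))) has_sum
        (conv k (v (\<sigma> n)) i + - conv k f i)) UNIV"
      unfolding conv_def by (intro has_sum_add has_sum_uminusI has_sum_infsum s v f)
    then show ?thesis
      unfolding conv_def[of k "w n"] by (intro infsumI) (simp add: w_def algebra_simps)
  qed
  have "(\<lambda>n. conv k (w n) i) \<longlonglongrightarrow> 0" for i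
    unfolding conv_def
    using pairing_tendsto_0[where w = w and h = "\<lambda>j. k (i - j)", OF w w_lim k' rqt(1) r'] .
  then have conv_lim: "(\<lambda>n. conv k (v (\<sigma> n)) i) \<longlonglongrightarrow> conv k f i" for i
    unfolding conv_w by (simp add: LIM_zero_iff)

  have max': "(\<lambda>n. lp_sum t (conv k (v (\<sigma> n)))) \<longlonglongrightarrow> B"
    unfolding conv_v using LIMSEQ_subseq_LIMSEQ[OF max \<sigma>] by (simp add: o_def)
  have split_r: "(\<lambda>n. 1 - lp_sum r (w n)) \<longlonglongrightarrow> lp_sum r f"
    using brezis_lieb[of "\<lambda>n. v (\<sigma> n)" r 1 f] v f f_lim rqt by (simp add: w_def[abs_def])
  have split_t: "(\<lambda>n. lp_sum t (conv k (v (\<sigma> n))) - lp_sum t (conv k (w n))) \<longlonglongrightarrow> lp_sum t (conv k f)"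
  proof -
    have "lp_sum t (conv k (v (\<sigma> n))) \<le> B" for n
      using B(2)[OF v(1), of "\<sigma> n"] v(2) by simp
    then have "(\<lambda>n. lp_sum t (conv k (v (\<sigma> n))) - lp_sum t (\<lambda>i. conv k (v (\<sigma> n)) i - conv k f i))
        \<longlonglongrightarrow> lp_sum t (conv k f)"
      using rqt by (intro brezis_lieb[where M = B] conv_lt v(1) f(1) conv_lim) auto
    then show ?thesis by (simp flip: conv_w)
  qed
  \<comment> \<open>The mass kept by the limit; the escaping part carries the mass \<open>1 - a\<close>.\<close>
  define a where "a = lp_sum r f"
  have w_sum: "(\<lambda>n. lp_sum r (w n)) \<longlonglongrightarrow> 1 - a"
    using tendsto_diff[OF tendsto_const[of 1] split_r] by (simp add: a_def)
  have conv_w_sum: "(\<lambda>n. lp_sum t (conv k (w n))) \<longlonglongrightarrow> B - lp_sum t (conv k f)"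
    using tendsto_diff[OF max' split_t] by simp
  have "(\<lambda>n. B * lp_sum r (w n) powr (t / r)) \<longlonglongrightarrow> B * (1 - a) powr (t / r)"
    using w_sum rqt by (intro tendsto_intros tendsto_powr') auto
  with conv_w_sum have "B - lp_sum t (conv k f) \<le> B * (1 - a) powr (t / r)"
    by (rule LIMSEQ_le) (use B(2)[OF w(1)] in blast)
  moreover have "lp_sum t (conv k f) \<le> B * a powr (t / r)"
    unfolding a_def by (rule B(2)[OF f(1)])
  ultimately have "B * 1 \<le> B * (a powr (t / r) + (1 - a) powr (t / r))"
    by (simp add: algebra_simps)
  then have "1 \<le> a powr (t / r) + (1 - a) powr (t / r)"
    using B(1) by (simp only: mult_le_cancel_left_pos)
  then have a: "a = 1"
    using powr_sum_less_1[of a "t / r"] f f_pos rqt \<rho> by (force simp: a_def)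
  have "(\<lambda>n. B * lp_sum r (w n) powr (t / r)) \<longlonglongrightarrow> 0"
    using \<open>(\<lambda>n. B * lp_sum r (w n) powr (t / r)) \<longlonglongrightarrow> _\<close> rqt by (simp add: a)
  then have "(\<lambda>n. lp_sum t (conv k (w n))) \<longlonglongrightarrow> 0"
    by (rule tendsto_sandwich[OF _ _ tendsto_const, rotated 2])
       (use B(2)[OF w(1)] in auto)
  from LIMSEQ_unique[OF this conv_w_sum] have "lp_sum t (conv k f) = B" by simp
  moreover have "(\<lambda>n. lp_sum r (\<lambda>i. fn (\<sigma> n) (i + tr (\<sigma> n)) - f i)) \<longlonglongrightarrow> 0"
    using w_sum by (simp add: a w_def[abs_def] v_def)
  ultimately show ?thesis
    using that[OF \<sigma> f(1)] a by (simp add: a_def)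
qed

section \<open>The Riesz kernel on the lattice\<close>

lemma summable_on_int_powr:
  assumes "p > (1::real)"
  shows "(\<lambda>m::int. max 1 \<bar>real_of_int m\<bar> powr - p) summable_on UNIV"
proof -
  have "summable (\<lambda>n. real n powr - p)"
    using assms by (simp add: summable_real_powr_iff)
  moreover have "eventually (\<lambda>n. max 1 (real n) powr - p = real n powr - p) sequentially"
    using eventually_ge_at_top[of 1] by eventually_elim (simp add: max_def)
  ultimately have "summable (\<lambda>n. max 1 (real n) powr - p)"
    by (simp only: summable_cong)
  then have nat: "(\<lambda>n. max 1 (real n) powr - p) summable_on UNIV"
    by (intro summable_nonneg_imp_summable_on) auto
  have pos: "(\<lambda>m::int. max 1 \<bar>real_of_int m\<bar> powr - p) summable_on range int"
    by (subst summable_on_reindex) (use nat in \<open>auto simp: o_def\<close>)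
  have neg: "(\<lambda>m::int. max 1 \<bar>real_of_int m\<bar> powr - p) summable_on range (\<lambda>n. - int n)"
    by (subst summable_on_reindex) (use nat in \<open>auto simp: o_def inj_on_def\<close>)
  have "m \<in> range int \<union> range (\<lambda>n. - int n)" for m
    by (cases m rule: int_cases2) auto
  then have "range int \<union> range (\<lambda>n. - int n) = UNIV" by blast
  with summable_on_union[OF pos neg] show ?thesis by simp
qed

lemma summable_on_prod_coordinates:
  fixes h :: "'b \<Rightarrow> real"
  assumes h: "h summable_on UNIV" "\<And>m. h m \<ge> 0"
  shows "(\<lambda>i::'b ^ 'n. \<Prod>k\<in>UNIV. h (i $ k)) summable_on UNIV"
proof (rule nonneg_bdd_above_summable_on)
  show "(\<Prod>k\<in>UNIV. h (i $ k)) \<ge> 0" for i :: "'b ^ 'n" using h by (simp add: prod_nonneg)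
  have "(\<Sum>i\<in>F. \<Prod>k\<in>UNIV. h (i $ k)) \<le> infsum h UNIV ^ CARD('n)" if "finite F" for F :: "('b ^ 'n) set"
  proof -
    define M where "M = (\<Union>k. (\<lambda>i. i $ k) ` F)"
    have M: "finite M" using that by (auto simp: M_def)
    have "(\<Sum>i\<in>F. \<Prod>k\<in>UNIV. h (i $ k)) = (\<Sum>x\<in>vec_nth ` F. \<Prod>k\<in>UNIV. h (x k))"
      by (subst sum.reindex) (auto simp: inj_on_def vec_nth_inject)
    also have "\<dots> \<le> (\<Sum>x\<in>PiE (UNIV :: 'n set) (\<lambda>_. M). \<Prod>k\<in>UNIV. h (x k))"
    proof (rule sum_mono2)
      show "finite (PiE (UNIV :: 'n set) (\<lambda>_. M))" using M by (simp add: finite_PiE)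
      show "vec_nth ` F \<subseteq> PiE UNIV (\<lambda>_. M)" by (auto simp: M_def)
    qed (use h in \<open>simp add: prod_nonneg\<close>)
    also have "\<dots> = (\<Prod>k\<in>(UNIV::'n set). sum h M)"
      using M by (subst prod_sum_PiE) auto
    also have "\<dots> \<le> (\<Prod>k\<in>(UNIV::'n set). infsum h UNIV)"
      using h M by (intro prod_mono) (auto intro: sum_nonneg finite_sum_le_infsum)
    finally show ?thesis by simp
  qed
  then show "bdd_above (sum (\<lambda>i::'b ^ 'n. \<Prod>k\<in>UNIV. h (i $ k)) ` {F. F \<subseteq> UNIV \<and> finite F})"
    by (intro bdd_aboveI2[where M = "infsum h UNIV ^ CARD('n)"]) auto
qed

text \<open>
  The kernel vanishes at the origin, because division by zero yields zero. Hence the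
  condition \<open>i \<noteq> j\<close> on the sums can be dropped.
\<close>

definition riesz_kernel :: "real \<Rightarrow> int ^ 'n \<Rightarrow> real"
  where "riesz_kernel l i = 1 / znorm i powr l"

lemma znorm_0 [simp]: "znorm 0 = 0"
  by (simp add: znorm_def flip: zero_vec_def)

lemma znorm_minus: "znorm (- i) = znorm i"
proof -
  have "(\<chi> k. real_of_int ((- i) $ k)) = - (\<chi> k. real_of_int (i $ k))" by (simp add: vec_eq_iff)
  then show ?thesis unfolding znorm_def by (simp only: norm_minus_cancel)
qed

lemma riesz_kernel_minus: "riesz_kernel l (i - j) = riesz_kernel l (j - i)"
  using znorm_minus[of "i - j"] by (simp add: riesz_kernel_def)

lemma znorm_ge_coordinate:
  assumes "i \<noteq> 0"
  shows "max 1 \<bar>real_of_int (i $ k)\<bar> \<le> znorm i"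
proof -
  have le: "\<bar>real_of_int (i $ k)\<bar> \<le> znorm i" for k
    using component_le_norm_cart[of "\<chi> k. real_of_int (i $ k)" k] by (simp add: znorm_def)
  obtain m where "i $ m \<noteq> 0" using assms by (auto simp: vec_eq_iff)
  then have "1 \<le> \<bar>real_of_int (i $ m)\<bar>" by linarith
  with le[of m] le[of k] show ?thesis by simp
qed

text \<open>
  Away from the origin \<open>\<bar>i\<bar>\<close> dominates \<open>max 1 \<bar>i\<^sub>k\<bar>\<close> for each of the \<open>N\<close> coordinates, so \<open>\<bar>i\<bar>\<^bsup>-lq\<^esup>\<close>
  is at most the product of the \<open>N\<close> factors \<open>(max 1 \<bar>i\<^sub>k\<bar>)\<^bsup>-lq/N\<^esup>\<close>, and \<open>lq/N > 1\<close>.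
\<close>

lemma riesz_kernel_in_lp_space:
  assumes "l > 0" "q > 0" "l * q > real CARD('n)"
  shows "(riesz_kernel l :: int ^ 'n \<Rightarrow> real) \<in> lp_space q"
proof -
  define p where "p = l * q / real CARD('n)"
  have p: "p > 1" "p * real CARD('n) = l * q" using assms by (auto simp: p_def field_simps)
  have "\<bar>riesz_kernel l i\<bar> powr q \<le> (\<Prod>k\<in>UNIV. max 1 \<bar>real_of_int (i $ k)\<bar> powr - p)" for i :: "int ^ 'n"
  proof (cases "i = 0")
    case True
    then show ?thesis by (simp add: riesz_kernel_def prod_nonneg)
  next
    case False
    note ge = znorm_ge_coordinate[OF False]
    have pos: "znorm i > 0" using ge[of undefined] by linarith
    have "\<bar>riesz_kernel l i\<bar> powr q = znorm i powr - (l * q)"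
      using pos by (simp add: riesz_kernel_def powr_divide powr_powr powr_minus_divide)
    also have "\<dots> = (\<Prod>k\<in>(UNIV::'n set). znorm i powr - p)"
      using pos p(2) by (simp add: powr_powr flip: powr_realpow)
    also have "\<dots> \<le> (\<Prod>k\<in>UNIV. max 1 \<bar>real_of_int (i $ k)\<bar> powr - p)"
      using ge p(1) by (intro prod_mono) (auto intro!: powr_mono2')
    finally show ?thesis .
  qed
  moreover have "(\<lambda>i::int ^ 'n. \<Prod>k\<in>UNIV. max 1 \<bar>real_of_int (i $ k)\<bar> powr - p) summable_on UNIV"
    by (rule summable_on_prod_coordinates[OF summable_on_int_powr[OF p(1)]]) simp
  ultimately show ?thesis using lp_space_comparison(1) by blast
qed

lemma riesz_conv_eq_conv: "riesz_conv l f = conv (riesz_kernel l) f"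
proof
  fix i
  show "riesz_conv l f i = conv (riesz_kernel l) f i"
    unfolding riesz_conv_def conv_def
    by (rule infsum_cong_neutral) (auto simp: riesz_kernel_def)
qed

text \<open>
  The kernel is even, so the roles of \<open>i\<close> and \<open>j\<close> may be exchanged; this brings the form to
  the shape in which the inner sum is the convolution of \<open>f\<close>.
\<close>

lemma hls_form_eq:
  "hls_form l f g = (\<Sum>\<^sub>\<infinity>(i, j). g i * (f j * riesz_kernel l (i - j)))"
proof -
  have "hls_form l f g = (\<Sum>\<^sub>\<infinity>(i, j). f i * g j * riesz_kernel l (i - j))"
    unfolding hls_form_def by (rule infsum_cong_neutral) (auto simp: riesz_kernel_def)
  also have "\<dots> = (\<Sum>\<^sub>\<infinity>(i, j). g i * (f j * riesz_kernel l (i - j)))"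
    by (rule infsum_reindex_bij_witness[of _ prod.swap prod.swap])
       (auto simp: riesz_kernel_minus mult_ac)
  finally show ?thesis .
qed

section \<open>Maximizers for the discrete Hardy--Littlewood--Sobolev inequality\<close>

text \<open>
  The Riesz kernel lies in \<open>\<ell>\<^sup>q\<close> when \<open>1/q < l/N\<close>. Since \<open>l/N\<close> exceeds the value of \<open>1/q\<close> that Young's
  inequality asks for, there is room for this value (the exponent \<open>q\<^sub>0\<close>, for boundedness) and for
  a larger one (the exponent \<open>q\<close>, for compactness).
\<close>

lemma supercritical_kernel_exponents:
  fixes N :: nat and r t l :: real
  assumes "r > 1" "t > 1" "0 < l" "l < real N" "1 / r + l / real N > 1 + 1 / t"
  obtains q\<^sub>0 q where "q\<^sub>0 > 1" "l * q\<^sub>0 > real N" "1 / r + 1 / q\<^sub>0 = 1 + 1 / t"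
    and "q > 1" "l * q > real N" "1 / r + 1 / q > 1 + 1 / t"
proof -
  define u where "u = l / real N"
  define x\<^sub>0 where "x\<^sub>0 = 1 + 1 / t - 1 / r"
  define x where "x = (x\<^sub>0 + u) / 2"
  have N: "real N > 0" using assms by linarith
  have inv: "1 / r < 1" "1 / t > 0" using assms by auto
  have "u < 1" using assms N by (simp add: u_def)
  moreover have "0 < x\<^sub>0" using inv unfolding x\<^sub>0_def by linarith
  moreover have "x\<^sub>0 < u" using assms(5) unfolding x\<^sub>0_def u_def by linarith
  ultimately have x: "0 < x\<^sub>0" "x\<^sub>0 < x" "x < u" "x < 1" "x\<^sub>0 < 1" "x\<^sub>0 < u"
    by (simp_all add: x_def)
  have big: "1 / y > 1 \<and> l * (1 / y) > real N" if "0 < y" "y < 1" "y < u" for y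
    using that N by (simp add: u_def field_simps)
  have sum: "1 / r + 1 / (1 / x\<^sub>0) = 1 + 1 / t" "1 / r + 1 / (1 / x) > 1 + 1 / t"
    using x(2) by (simp_all add: x\<^sub>0_def)
  show ?thesis
    using that[OF _ _ sum(1) _ _ sum(2)] big[of x\<^sub>0] big[of x] x by auto
qed

theorem theorem3:
  fixes r s t l :: real
    and K :: ereal
    and fn :: "nat \<Rightarrow> int ^ 'n \<Rightarrow> real"
  assumes "r > 1" and "s > 1" and "t > 1"
    and "0 < l" and "l < real CARD('n)"
    and "1 / t + 1 / s = 1"
    and "1 / r + l / real CARD('n) > 1 + 1 / t"
    and "K = (SUP f \<in> {f :: int ^ 'n \<Rightarrow> real. f \<in> lp_space r \<and> lp_norm r f = 1}.
                lp_norm t (riesz_conv l f))"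
    and "\<And>n. fn n \<in> lp_space r"
    and "\<And>n. lp_norm r (fn n) = 1"
    and "(\<lambda>n. lp_norm t (riesz_conv l (fn n))) \<longlonglongrightarrow> K"
  shows "\<exists>(tr :: nat \<Rightarrow> int ^ 'n) (\<sigma> :: nat \<Rightarrow> nat) (f :: int ^ 'n \<Rightarrow> real).
      strict_mono \<sigma> \<and> f \<in> lp_space r \<and>
      (\<lambda>n. lp_norm r (\<lambda>i. fn (\<sigma> n) (i + tr (\<sigma> n)) - f i)) \<longlonglongrightarrow> 0 \<and>
      lp_norm r f = 1 \<and> lp_norm t (riesz_conv l f) = K \<and>
      (\<exists>g :: int ^ 'n \<Rightarrow> real. g \<in> lp_space s \<and> lp_norm s g = 1 \<and>
        ereal (hls_form l f g) =
          (SUP (f', g') \<in> {(f' :: int ^ 'n \<Rightarrow> real, g' :: int ^ 'n \<Rightarrow> real).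
                                f' \<in> lp_space r \<and> g' \<in> lp_space s \<and>
                                lp_norm r f' = 1 \<and> lp_norm s g' = 1}.
             ereal (hls_form l f' g')))"
proof -
  define k :: "int ^ 'n \<Rightarrow> real" where "k = riesz_kernel l"
  have conv_k: "riesz_conv l f = conv k f" for f
    by (simp add: k_def riesz_conv_eq_conv)
  have unit_iff: "lp_norm p f = 1 \<longleftrightarrow> f \<in> lp_space p \<and> lp_sum p f = 1" if "p > 1"
    for p and f :: "int ^ 'n \<Rightarrow> real"
    using that by (intro lp_norm_eq_1_iff) simp
  obtain q\<^sub>0 q where q\<^sub>0: "q\<^sub>0 > 1" "l * q\<^sub>0 > real CARD('n)" "1 / r + 1 / q\<^sub>0 = 1 + 1 / t"
    and q: "q > 1" "l * q > real CARD('n)" "1 / r + 1 / q > 1 + 1 / t"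
    using supercritical_kernel_exponents[OF assms(1,3,4,5,7)] by blast
  have k: "k \<in> lp_space q\<^sub>0" "k \<in> lp_space q"
    unfolding k_def using q\<^sub>0 q assms(4) by (auto intro!: riesz_kernel_in_lp_space)
  obtain C where C: "\<And>f. f \<in> lp_space r \<Longrightarrow>
        conv k f \<in> lp_space t \<and> lp_sum t (conv k f) \<le> C * lp_sum r f powr (t / r)"
    using young_convolution[OF k(1) assms(1) q\<^sub>0(1) assms(3) q\<^sub>0(3)] by blast
  have norm_conv: "lp_norm t (riesz_conv l f) = ereal (lp_sum t (conv k f) powr (1 / t))"
    if "f \<in> lp_space r" for f
    unfolding conv_k using C[OF that] by (intro lp_norm_eq_lp_sum) simp
  have le_K: "ereal (lp_sum t (conv k f) powr (1 / t)) \<le> K" if "f \<in> lp_space r" "lp_sum r f = 1" for f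
    unfolding assms(8) norm_conv[OF that(1), symmetric]
    using that assms(1) by (intro SUP_upper) (simp add: unit_iff)

  \<comment> \<open>Young's inequality makes \<open>K\<close> finite; a point mass, whose convolution is the kernel, makes it positive.\<close>
  have "K \<le> ereal (C powr (1 / t))"
    unfolding assms(8)
  proof (rule SUP_least)
    fix f :: "int ^ 'n \<Rightarrow> real"
    assume "f \<in> {f. f \<in> lp_space r \<and> lp_norm r f = 1}"
    then have f: "f \<in> lp_space r" "lp_sum r f = 1" using unit_iff[OF assms(1)] by auto
    then have "lp_sum t (conv k f) \<le> C" using C[OF f(1)] by simp
    then show "lp_norm t (riesz_conv l f) \<le> ereal (C powr (1 / t))"
      unfolding norm_conv[OF f(1)] ereal_less_eq using assms(3) by (intro powr_mono2) auto
  qed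
  moreover have "K > 0"
  proof -
    define \<delta> :: "int ^ 'n \<Rightarrow> real" where "\<delta> j = (if j = 0 then 1 else 0)" for j
    have \<delta>: "\<delta> \<in> lp_space r"
      by (rule lp_space_finite_support, rule finite_subset[of _ "{0}"]) (auto simp: \<delta>_def)
    have "lp_sum r \<delta> = (\<Sum>\<^sub>\<infinity>j\<in>{0}. \<bar>\<delta> j\<bar> powr r)"
      unfolding lp_sum_def by (rule infsum_cong_neutral) (auto simp: \<delta>_def)
    then have \<delta>1: "lp_sum r \<delta> = 1" by (simp add: \<delta>_def)
    have "conv k \<delta> i = (\<Sum>\<^sub>\<infinity>j\<in>{0}. \<delta> j * k (i - j))" for i
      unfolding conv_def by (rule infsum_cong_neutral) (auto simp: \<delta>_def)
    then have conv_\<delta>: "conv k \<delta> = k" by (auto simp: \<delta>_def)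
    define e :: "int ^ 'n" where "e = 1"
    have "e \<noteq> 0" by (simp add: e_def)
    then have "znorm e > 0" using znorm_ge_coordinate[of e undefined] by linarith
    then have "0 < \<bar>k e\<bar> powr t" by (simp add: k_def riesz_kernel_def)
    also have "\<dots> \<le> lp_sum t k"
      using C[OF \<delta>] by (intro powr_le_lp_sum) (simp add: conv_\<delta>)
    finally have "0 < ereal (lp_sum t (conv k \<delta>) powr (1 / t))" by (simp add: conv_\<delta>)
    also have "\<dots> \<le> K" by (rule le_K[OF \<delta> \<delta>1])
    finally show ?thesis .
  qed
  ultimately obtain \<kappa> where \<kappa>: "K = ereal \<kappa>" "\<kappa> > 0"
    by (cases K) auto

  have unit_bound: "conv k f \<in> lp_space t \<and> lp_sum t (conv k f) \<le> \<kappa> powr t"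
    if "f \<in> lp_space r" "lp_sum r f = 1" for f
  proof -
    have "lp_sum t (conv k f) powr (1 / t) \<le> \<kappa>" using le_K[OF that] \<kappa> by simp
    then have "(lp_sum t (conv k f) powr (1 / t)) powr t \<le> \<kappa> powr t"
      using assms(3) by (intro powr_mono2) auto
    then show ?thesis using C[OF that(1)] assms(3) by (simp add: powr_powr)
  qed
  have fn: "fn n \<in> lp_space r" "lp_sum r (fn n) = 1" for n
    using assms(9,10) unit_iff[OF assms(1)] by auto
  have "(\<lambda>n. lp_sum t (conv k (fn n)) powr (1 / t)) \<longlonglongrightarrow> \<kappa>"
    using assms(11) by (simp add: norm_conv fn \<kappa>)
  then have "(\<lambda>n. (lp_sum t (conv k (fn n)) powr (1 / t)) powr t) \<longlonglongrightarrow> \<kappa> powr t"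
    using \<kappa> by (intro tendsto_intros) auto
  then have max: "(\<lambda>n. lp_sum t (conv k (fn n))) \<longlonglongrightarrow> \<kappa> powr t"
    using assms(3) by (simp add: powr_powr)
  have bound: "lp_sum t (conv k f) \<le> \<kappa> powr t * lp_sum r f powr (t / r)" if "f \<in> lp_space r" for f
    using homogeneous_conv_bound[OF that assms(1) unit_bound] by simp
  have "\<kappa> powr t > 0" using \<kappa> by simp
  obtain tr \<sigma> f where \<sigma>: "strict_mono \<sigma>" and f: "f \<in> lp_space r"
    and lim: "(\<lambda>n. lp_sum r (\<lambda>i. fn (\<sigma> n) (i + tr (\<sigma> n)) - f i)) \<longlonglongrightarrow> 0"
    and f1: "lp_sum r f = 1"
    and maximizer: "lp_sum t (conv k f) = \<kappa> powr t"
    by (rule maximizing_sequence_convergent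
        [OF k(2) assms(1) q(1) assms(3) q(3) \<open>\<kappa> powr t > 0\<close> bound fn max]) (assumption, rule that)

  \<comment> \<open>The supremum of the form is at most \<open>K\<close> by Hoelder's inequality, and \<open>g\<close> attains this bound.\<close>
  define g where "g = dual_extremal t (conv k f)"
  have cf: "conv k f \<in> lp_space t" using C[OF f] by simp
  have root: "(\<kappa> powr t) powr (1 / t) = \<kappa>" using \<kappa> assms(3) by (simp add: powr_powr)
  have g: "g \<in> lp_space s" "lp_sum s g = 1" "(\<Sum>\<^sub>\<infinity>i. g i * conv k f i) = \<kappa>"
    using dual_extremal[OF cf _ assms(3,2,6)] \<open>\<kappa> powr t > 0\<close> by (simp_all add: g_def maximizer root)
  have exps: "1 / r + 1 / q\<^sub>0 + 1 / s = 2" using q\<^sub>0(3) assms(6) by linarith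
  have form: "hls_form l f' g' = (\<Sum>\<^sub>\<infinity>i. g' i * conv k f' i)"
    if "f' \<in> lp_space r" "g' \<in> lp_space s" for f' g'
    unfolding hls_form_eq k_def[symmetric]
    by (rule young_form_iterated(2)[OF that k(1) assms(1) q\<^sub>0(1) assms(2) exps])
  have "ereal (hls_form l f g) =
      (SUP (f', g') \<in> {(f' :: int ^ 'n \<Rightarrow> real, g' :: int ^ 'n \<Rightarrow> real).
            f' \<in> lp_space r \<and> g' \<in> lp_space s \<and> lp_norm r f' = 1 \<and> lp_norm s g' = 1}.
         ereal (hls_form l f' g'))" (is "_ = (SUP (f', g') \<in> ?P. _)")
  proof (rule antisym)
    have "(f, g) \<in> ?P" using f f1 g unit_iff assms(1,2) by simp
    then show "ereal (hls_form l f g) \<le> (SUP (f', g') \<in> ?P. ereal (hls_form l f' g'))"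
      by (rule SUP_upper2) simp
    show "(SUP (f', g') \<in> ?P. ereal (hls_form l f' g')) \<le> ereal (hls_form l f g)"
    proof (rule SUP_least, clarify)
      fix f' g' :: "int ^ 'n \<Rightarrow> real"
      assume *: "f' \<in> lp_space r" "g' \<in> lp_space s" "lp_norm r f' = 1" "lp_norm s g' = 1"
      then have "lp_sum r f' = 1" "lp_sum s g' = 1" using unit_iff assms(1,2) by auto
      then have "hls_form l f' g' \<le> \<kappa>"
        unfolding form[OF *(1,2)] using unit_bound[OF *(1)] *(2) assms(2,3,6) \<kappa>(2)
        by (intro holder_unit_le) auto
      then show "ereal (hls_form l f' g') \<le> ereal (hls_form l f g)"
        by (simp add: form[OF f g(1)] g(3))
    qed
  qed
  moreover have "(\<lambda>n. lp_norm r (\<lambda>i. fn (\<sigma> n) (i + tr (\<sigma> n)) - f i)) \<longlonglongrightarrow> 0"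
  proof -
    have d: "(\<lambda>i. fn (\<sigma> n) (i + tr (\<sigma> n)) - f i) \<in> lp_space r" for n
      using lp_space_reindex(1)[OF bij_translate, where f = "fn (\<sigma> n)"] fn(1) f assms(1)
      by (intro lp_space_diff) auto
    have "(\<lambda>n. lp_sum r (\<lambda>i. fn (\<sigma> n) (i + tr (\<sigma> n)) - f i) powr (1 / r)) \<longlonglongrightarrow> 0 powr (1 / r)"
      using lim assms(1) by (intro tendsto_powr') auto
    then show ?thesis by (simp add: lp_norm_eq_lp_sum[OF d] zero_ereal_def)
  qed
  moreover have "lp_norm t (riesz_conv l f) = K"
    by (simp add: norm_conv[OF f] maximizer root \<kappa>)
  ultimately show ?thesis
    using \<sigma> f f1 g unit_iff assms(1,2) by blast
qed

end
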